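(* Let $n\geqslant 1$, $q\in L_{1,\mathrm{loc}}([0,\infty);\mathbb M^n_{\mathbb C})$, let $f\in C^{\infty}([0,\infty);\mathbb C^n)$ with $\operatorname{supp} f\subset(0,\infty)$, and let $w$ be the kernel associated with $q$ (defined in the context). Then the function $$u^{f}(x,t)=f(t-x)+\int_x^t w(x,s)f(t-s)\,ds,\qquad x\geqslant 0,\ t\geqslant 0,$$ solves the system $$u_{tt}(x,t)-u_{xx}(x,t)+q(x)u(x,t)=0\quad\text{for every } t>0 \text{ and a.e. } x\in(0,t),$$ $$u(x,t)=0\quad\text{for } x\geqslant t,$$ $$u(0,t)=f(t)\quad\text{for } t\geqslant 0.$$ Moreover, for every $t\geqslant 0$ one has $$u^{f}(\cdot,t)\in W^2_1([0,t];\mathbb C^n)\quad\text{and}\quad -u^{f}_{xx}(\cdot,t)+q(\cdot)u^{f}(\cdot,t)\in C([0,t];\mathbb C^n).$$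
   Context: $\mathbb M^n_{\mathbb C}$ is the space of complex $n\times n$ matrices. $L_{1,\mathrm{loc}}([0,\infty);\mathbb M^n_{\mathbb C})$ is the space of (classes of) measurable matrix-valued functions summable on $[0,T]$ for every $T>0$. $W^2_1([0,t];\mathbb C^n)$ is the Sobolev space of functions $y$ on $[0,t]$ such that $y,y'$ are absolutely continuous and $y''\in L_1([0,t];\mathbb C^n)$. Membership of $-u^f_{xx}(\cdot,t)+q(\cdot)u^f(\cdot,t)$ in $C([0,t];\mathbb C^n)$ means that it agrees a.e. with a continuous function. $\operatorname{supp} f$ is the closed support, so $f$ vanishes near $0$. The kernel $w$: let $v(\xi,\eta)$, $0\leqslant\xi\leqslant\eta<\infty$, be the unique continuous $\mathbb M^n_{\mathbb C}$-valued solution of the integral equation $$v(\xi,\eta)=-\frac12\int_{\xi/2}^{\eta/2}q(s)\,ds-\frac14\int_0^{\xi}d\xi_1\int_{\xi}^{\eta}d\eta_1\,q\Big(\frac{\eta_1-\xi_1}{2}\Big)v(\xi_1,\eta_1),$$ and put $w(x,t):=v(t-x,t+x)$ for $0\leqslant x\leqslant t<\infty$. (This is the integral form of the Goursat problem $w_{tt}-w_{xx}+q(x)w=0$ for $0<x<t$, $w(0,t)=0$, $w(x,x)=-\frac12\int_0^xq(s)ds$.) The function $f$ is continued to the negative half-line by zero, and for $x>t$ the integral term in $u^f$ is taken to be zero, so that $u^f(x,t)=0$ for $x>t$. *)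

theory Defs
  imports "HOL-Analysis.Analysis"
begin

text \<open>
  A function on the half-line is represented by a total function on the reals of which only
  the values on the half-line matter. Since \<^const>\<open>absolutely_integrable_on\<close> is Lebesgue
  integrability, the gauge integral \<^const>\<open>integral\<close> is the Lebesgue integral wherever it is
  used below.
\<close>

definition L1_loc :: "(real \<Rightarrow> 'a::euclidean_space) \<Rightarrow> bool" where
  "L1_loc q \<longleftrightarrow> (\<forall>T>0. q absolutely_integrable_on {0..T})"

definition smooth_on_halfline :: "(real \<Rightarrow> 'a::real_normed_vector) \<Rightarrow> bool" where
  "smooth_on_halfline f \<longleftrightarrow>
     (\<exists>D :: nat \<Rightarrow> real \<Rightarrow> 'a.
        (\<forall>x\<ge>0. D 0 x = f x) \<and>
        (\<forall>k. \<forall>x\<ge>0. (D k has_vector_derivative D (Suc k) x) (at x within {0..})))"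

definition zero_extension :: "(real \<Rightarrow> 'a::zero) \<Rightarrow> real \<Rightarrow> 'a" where
  "zero_extension f t = (if t < 0 then 0 else f t)"

definition goursat_region :: "(real \<times> real) set" where
  "goursat_region = {(\<xi>, \<eta>). 0 \<le> \<xi> \<and> \<xi> \<le> \<eta>}"

definition goursat_equation ::
  "(real \<Rightarrow> complex^'n^'n) \<Rightarrow> (real \<Rightarrow> real \<Rightarrow> complex^'n^'n) \<Rightarrow> bool" where
  "goursat_equation q v \<longleftrightarrow>
     (\<forall>\<xi> \<eta>. 0 \<le> \<xi> \<and> \<xi> \<le> \<eta> \<longrightarrow>
        v \<xi> \<eta> =
          - ((1/2) *\<^sub>R integral {\<xi>/2..\<eta>/2} q)
          - (1/4) *\<^sub>R integral {0..\<xi>} (\<lambda>\<xi>1. integral {\<xi>..\<eta>} (\<lambda>\<eta>1. q ((\<eta>1 - \<xi>1) / 2) ** v \<xi>1 \<eta>1)))"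

text \<open>
  The equation determines the continuous solution on the region only; the value zero elsewhere
  is a normalisation that makes the total function unique.
\<close>

definition goursat_solution ::
  "(real \<Rightarrow> complex^'n^'n) \<Rightarrow> real \<Rightarrow> real \<Rightarrow> complex^'n^'n" where
  "goursat_solution q =
     (THE v. continuous_on goursat_region (\<lambda>(\<xi>, \<eta>). v \<xi> \<eta>) \<and>
             goursat_equation q v \<and>
             (\<forall>\<xi> \<eta>. (\<xi>, \<eta>) \<notin> goursat_region \<longrightarrow> v \<xi> \<eta> = 0))"

definition kernel_w ::
  "(real \<Rightarrow> complex^'n^'n) \<Rightarrow> real \<Rightarrow> real \<Rightarrow> complex^'n^'n" where
  "kernel_w q x t = goursat_solution q (t - x) (t + x)"

text \<open>For \<open>x > t\<close> the interval of integration is empty and the integral is zero.\<close>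

definition wave ::
  "(real \<Rightarrow> complex^'n^'n) \<Rightarrow> (real \<Rightarrow> complex^'n) \<Rightarrow> real \<Rightarrow> real \<Rightarrow> complex^'n" where
  "wave q f x t =
     zero_extension f (t - x) + integral {x..t} (\<lambda>s. kernel_w q x s *v zero_extension f (t - s))"

definition has_second_derivative ::
  "(real \<Rightarrow> 'a::real_normed_vector) \<Rightarrow> 'a \<Rightarrow> real \<Rightarrow> bool" where
  "has_second_derivative y D x \<longleftrightarrow>
     (\<exists>y'. (\<forall>\<^sub>F z in nhds x. (y has_vector_derivative y' z) (at z)) \<and>
           (y' has_vector_derivative D) (at x))"

definition abs_continuous_on_interval ::
  "real \<Rightarrow> real \<Rightarrow> (real \<Rightarrow> 'a::real_normed_vector) \<Rightarrow> bool" where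
  "abs_continuous_on_interval a b y \<longleftrightarrow>
     (\<forall>\<epsilon>>0. \<exists>\<delta>>0. \<forall>P :: (real \<times> real) set.
        finite P \<and>
        (\<forall>(c, d)\<in>P. a \<le> c \<and> c \<le> d \<and> d \<le> b) \<and>
        pairwise (\<lambda>I J. disjnt {fst I<..<snd I} {fst J<..<snd J}) P \<and>
        (\<Sum>(c, d)\<in>P. d - c) < \<delta>
        \<longrightarrow> (\<Sum>(c, d)\<in>P. norm (y d - y c)) < \<epsilon>)"

text \<open>
  The derivative is one-sided at the endpoints. In the degenerate case \<open>t = 0\<close> every function
  belongs to the space.
\<close>

definition sobolev_W21 :: "real \<Rightarrow> (real \<Rightarrow> 'a::euclidean_space) \<Rightarrow> bool" where
  "sobolev_W21 t y \<longleftrightarrow>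
     (\<exists>y' y''.
        (\<forall>x\<in>{0..t}. (y has_vector_derivative y' x) (at x within {0..t})) \<and>
        abs_continuous_on_interval 0 t y \<and>
        abs_continuous_on_interval 0 t y' \<and>
        (AE x in lebesgue. x \<in> {0<..<t} \<longrightarrow> (y' has_vector_derivative y'' x) (at x)) \<and>
        y'' absolutely_integrable_on {0..t})"

end

theory Submission
  imports Defs
begin

text \<open>
  Put \<open>V x s = w(x, x + s) = v(s, s + 2 x)\<close>, a function on the quadrant \<open>x, s \<ge> 0\<close>. Interchanging the integrals
  turns the Goursat equation into \<open>V = g - K V\<close>, where
  \<open>K V x s = 1/2 \<integral> q(y) [A(y, min s (s + 2 x - 2 y)) - A(y, s - 2 y)] dy\<close> and \<open>A\<close> is the primitive of \<open>V\<close> in the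
  second variable that vanishes for nonpositive arguments. In this form \<open>q\<close> is only ever multiplied by
  continuous functions, and \<open>K\<close> contracts in an exponentially weighted norm, which yields the unique continuous
  solution.

  Convolving \<open>V = g - K V\<close> with \<open>F = f\<close> (extended by zero) in the variable \<open>s\<close> gives d'Alembert's formula
  \<open>u\<^sup>F(x, t) = F(t - x) - 1/2 \<integral> q(y) [P(y, t - \<bar>x - y\<bar>) - P(y, t - x - y)] dy\<close>, where \<open>P\<close> is the antiderivative of
  \<open>u\<^sup>F\<close> in time, that is, the function \<open>u\<close> belonging to the antiderivative of \<open>F\<close>. The kernel is never
  differentiated: \<open>x\<close> enters only through the smooth time argument. Two differentiations in \<open>x\<close>, performed in
  integrated form by Fubini's theorem, produce the same formula for \<open>F''\<close>, i.e. \<open>u\<^sub>t\<^sub>t\<close>, plus the term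
  \<open>q(x) u(x, t)\<close> from the corner of \<open>\<bar>x - y\<bar>\<close>. Hence \<open>u\<^sub>x\<close> is the indefinite integral of \<open>u\<^sub>t\<^sub>t + q u\<close>, and Lebesgue's
  differentiation theorem gives the equation almost everywhere.
\<close>

section \<open>Indefinite integrals\<close>

text \<open>The obstacle is that \<open>q\<close> is merely integrable: the kernel is then only
  continuous in general, so the integral term of the wave cannot be differentiated through the
  kernel. In the variables \<open>x\<close> and \<open>s = t - x\<close> the point \<open>y\<close>
  at which \<open>q\<close> is evaluated becomes the variable of integration, and the parameters
  move into the time arguments of the other factor. All smoothness is taken from the control. Since
  \<open>f\<close> vanishes near 0, its extension by zero is a second antiderivative of a continuous
  \<open>G\<close> that vanishes for nonpositive arguments. Convolution commutes with
  antiderivatives, so the response to \<open>G\<close> is the second time derivative. D'Alembert's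
  formula for a control involves the response to its antiderivative; hence four consecutive levels
  occur, from \<open>G\<close> up to the antiderivative of \<open>F\<close>. The corner term arises
  because the derivative of P(y, t - |x - y|) in \<open>x\<close> carries the factor - sgn(x - y):
  its jump of size 2 at \<open>y = x\<close> cancels the factor 1/2 and leaves q(x) u(x, t). The
  contraction works on bounded triangles of any size: integrating exp(L z) gains a factor 1/L, which
  outweighs the mass of \<open>q\<close> on the triangle once \<open>L\<close> is large.\<close>

text \<open>Henstock's lemma bounds the total length of any disjoint family of intervals with bad difference
  quotients; a Vitali covering by such intervals then forces the set to be negligible.\<close>

lemma negligible_bad_difference_quotients:
  fixes f :: "real \<Rightarrow> 'a::euclidean_space"
  assumes f: "f integrable_on {a..b}" and "e > 0"
  defines "bad \<equiv> \<lambda>x u v. a \<le> u \<and> u \<le> x \<and> x \<le> v \<and> v \<le> b \<and> u < v \<and>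
                     e * (v - u) < norm ((v - u) *\<^sub>R f x - integral {u..v} f)"
  shows "negligible {x. \<forall>d>0. \<exists>u v. v - u < d \<and> bad x u v}" (is "negligible ?S")
  unfolding negligible_outer_le
proof (intro allI impI)
  fix \<eta> :: real assume "\<eta> > 0"
  then have "\<eta> * e > 0" using \<open>e > 0\<close> by simp
  \<comment> \<open>The tolerance is \<open>\<eta> * e\<close> because each bad interval contributes
    more than \<open>e\<close> times its length to Henstock's sum; dividing by \<open>e\<close>
    bounds the total length by \<open>\<eta>\<close>.\<close>
  then obtain \<gamma> where "gauge \<gamma>"
    and \<gamma>: "\<And>p. \<lbrakk>p tagged_partial_division_of (cbox a b); \<gamma> fine p\<rbrakk> \<Longrightarrow>
             sum (\<lambda>(x,k). norm (measure lborel k *\<^sub>R f x - integral k f)) p < \<eta> * e"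
    using Henstock_lemma[of f a b "\<eta> * e"] f by auto
  \<comment> \<open>The index carries the bad point itself as the tag, and the interval lies inside
    \<open>\<gamma> x\<close>, so every finite disjoint subfamily is a fine tagged partial division.
    Centre and radius present the interval as a closed ball, the form in which the Vitali theorem
    speaks.\<close>
  define K where "K = {(x, u, v). bad x u v \<and> {u..v} \<subseteq> \<gamma> x}"
  define cen where "cen = (\<lambda>(x::real, u::real, v::real). (u + v) / 2)"
  define rad where "rad = (\<lambda>(x::real, u::real, v::real). (v - u) / 2)"
  have cb: "cball (cen (x, u, v)) (rad (x, u, v)) = {u..v}" for x u v
    unfolding cen_def rad_def by (auto simp: dist_real_def abs_real_def field_simps split: if_splits)
  obtain C where C: "countable C" "C \<subseteq> K"
     "pairwise (\<lambda>i j. disjnt (cball (cen i) (rad i)) (cball (cen j) (rad j))) C"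
     "negligible (?S - (\<Union>i \<in> C. cball (cen i) (rad i)))"
  proof (rule Vitali_covering_theorem_cballs[of K rad ?S cen])
    show "0 < rad i" if "i \<in> K" for i
      using that by (auto simp: K_def bad_def rad_def)
    show "\<exists>i. i \<in> K \<and> x \<in> cball (cen i) (rad i) \<and> rad i < d" if xS: "x \<in> ?S" and "0 < d" for x d
    proof -
      have "open (\<gamma> x)" "x \<in> \<gamma> x" using \<open>gauge \<gamma>\<close> by (auto simp: gauge_def)
      then obtain r where r: "r > 0" "ball x r \<subseteq> \<gamma> x" using open_contains_ball by blast
      have "\<forall>d>0. \<exists>u v. v - u < d \<and> bad x u v" using xS by simp
      moreover have "0 < min r d" using r \<open>0 < d\<close> by simp
      ultimately obtain u v where uv: "v - u < min r d" "bad x u v" by meson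
      have "{u..v} \<subseteq> ball x r" using uv by (auto simp: bad_def dist_real_def)
      then have "(x, u, v) \<in> K" using uv r by (auto simp: K_def)
      moreover have "x \<in> cball (cen (x, u, v)) (rad (x, u, v))" unfolding cb using uv by (auto simp: bad_def)
      moreover have "rad (x, u, v) < d" using uv by (auto simp: rad_def bad_def)
      ultimately show ?thesis by blast
    qed
  qed auto
  define I where "I = (\<lambda>i. cball (cen i) (rad i))"
  have bound: "(\<Sum>i\<in>F. 2 * rad i) \<le> \<eta>" if F: "F \<subseteq> C" "finite F" for F
  proof -
    define tg where "tg = (\<lambda>(x::real, u::real, v::real). (x, {u..v}))"
    have FK: "F \<subseteq> K" using F C by auto
    have inj: "inj_on tg F"
    proof (rule inj_onI)
      fix i j assume *: "i \<in> F" "j \<in> F" "tg i = tg j"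
      obtain x u v x' u' v' where ij: "i = (x, u, v)" "j = (x', u', v')" by (cases i, cases j) auto
      have "(x, u, v) \<in> K" "(x', u', v') \<in> K" using FK * ij by auto
      then have "u < v" "u' < v'" by (simp_all add: K_def bad_def)
      with *(3) show "i = j" by (simp add: tg_def Icc_eq_Icc ij)
    qed
    have dis: "interior (snd (tg i)) \<inter> interior (snd (tg j)) = {}" if "i \<in> F" "j \<in> F" "i \<noteq> j" for i j
    proof -
      obtain x u v x' u' v' where ij: "i = (x, u, v)" "j = (x', u', v')" by (cases i, cases j) auto
      have "disjnt (cball (cen i) (rad i)) (cball (cen j) (rad j))"
        using C(3) that F(1) by (auto simp: pairwise_def)
      then have "{u..v} \<inter> {u'..v'} = {}" unfolding ij cb by (auto simp: disjnt_def)
      then show ?thesis unfolding ij tg_def prod.case snd_conv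
        using interior_subset by blast
    qed
    have p: "(tg ` F) tagged_partial_division_of (cbox a b)"
      unfolding tagged_partial_division_of_def
    proof (intro conjI allI impI)
      show "finite (tg ` F)" using F by simp
      fix x k
      { assume "(x, k) \<in> tg ` F"
        then obtain u v where uv: "k = {u..v}" "(x, u, v) \<in> K" using FK by (force simp: tg_def)
        then show "x \<in> k" "k \<subseteq> cbox a b" "\<exists>u v. k = cbox u v"
          by (auto simp: K_def bad_def) }
      fix x' k' assume *: "(x, k) \<in> tg ` F \<and> (x', k') \<in> tg ` F \<and> (x, k) \<noteq> (x', k')"
      then obtain i j where "i \<in> F" "j \<in> F" "tg i = (x, k)" "tg j = (x', k')" by (metis imageE)
      then show "interior k \<inter> interior k' = {}" using dis[of i j] * by (metis snd_conv)
    qed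
    have fine: "\<gamma> fine (tg ` F)"
      using FK by (auto simp: fine_def K_def tg_def)
    have "e * (\<Sum>i\<in>F. 2 * rad i) = (\<Sum>i\<in>F. e * (2 * rad i))" by (rule sum_distrib_left)
    also have "\<dots> \<le> (\<Sum>i\<in>F. (\<lambda>(x,k). norm (measure lborel k *\<^sub>R f x - integral k f)) (tg i))"
    proof (intro sum_mono)
      fix i assume "i \<in> F"
      then obtain x u v where "i = (x, u, v)" "bad x u v" using FK by (cases i) (auto simp: K_def)
      then show "e * (2 * rad i) \<le> (\<lambda>(x,k). norm (measure lborel k *\<^sub>R f x - integral k f)) (tg i)"
        by (simp add: tg_def rad_def bad_def right_diff_distrib)
    qed
    also have "\<dots> = sum (\<lambda>(x,k). norm (measure lborel k *\<^sub>R f x - integral k f)) (tg ` F)"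
      by (simp add: sum.reindex[OF inj])
    also have "\<dots> < \<eta> * e" by (rule \<gamma>[OF p fine])
    finally show ?thesis using \<open>e > 0\<close> by (simp add: mult.commute[of \<eta>])
  qed
  have m: "measure lebesgue (\<Union>i\<in>F. I i) \<le> \<eta>" if F: "F \<subseteq> C" "finite F" for F
  proof -
    have "measure lebesgue (\<Union>i\<in>F. I i) \<le> (\<Sum>i\<in>F. measure lebesgue (I i))"
      by (intro measure_UNION_le) (auto simp: I_def F)
    also have "\<dots> = (\<Sum>i\<in>F. 2 * rad i)"
    proof (intro sum.cong refl)
      fix i assume "i \<in> F"
      then obtain x u v where i: "i = (x, u, v)" "bad x u v" using F C by (cases i) (auto simp: K_def)
      show "measure lebesgue (I i) = 2 * rad i"
        unfolding I_def i(1) cb using i(2) by (simp add: rad_def bad_def)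
    qed
    also have "\<dots> \<le> \<eta>" by (rule bound[OF F])
    finally show ?thesis .
  qed
  \<comment> \<open>Vitali's family is only countable, Henstock's bound only for finite families; a
    bound uniform in the finite subfamilies passes to the countable union.\<close>
  have lm: "I i \<in> lmeasurable" for i by (simp add: I_def)
  have U: "(\<Union>i\<in>C. I i) \<in> lmeasurable" "measure lebesgue (\<Union>i\<in>C. I i) \<le> \<eta>"
    by (rule fmeasurable_UN_bound[OF C(1) lm m] measure_UN_bound[OF C(1) lm m]; assumption)+
  have N: "?S - (\<Union>i\<in>C. I i) \<in> lmeasurable" "measure lebesgue (?S - (\<Union>i\<in>C. I i)) = 0"
    using C(4) by (auto simp: I_def negligible_imp_measurable negligible_imp_measure0)
  show "\<exists>T. ?S \<subseteq> T \<and> T \<in> lmeasurable \<and> measure lebesgue T \<le> \<eta>"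
  proof (intro exI conjI)
    show "?S \<subseteq> (\<Union>i\<in>C. I i) \<union> (?S - (\<Union>i\<in>C. I i))" by auto
    show "(\<Union>i\<in>C. I i) \<union> (?S - (\<Union>i\<in>C. I i)) \<in> lmeasurable" using U N by blast
    show "measure lebesgue ((\<Union>i\<in>C. I i) \<union> (?S - (\<Union>i\<in>C. I i))) \<le> \<eta>"
      using measure_Un_le[of "\<Union>i\<in>C. I i" lebesgue "?S - (\<Union>i\<in>C. I i)", OF fmeasurableD[OF U(1)] fmeasurableD[OF N(1)]]
        U(2) N(2) by linarith
  qed
qed

text \<open>Outside the union of the negligible sets belonging to e = 1/(n + 1), every sufficiently
  short interval containing \<open>x\<close> has a good difference quotient. Applying this to the
  intervals with \<open>x\<close> as one endpoint gives both one-sided limits. This is Lebesgue's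
  differentiation theorem for the gauge integral.\<close>

theorem indefinite_integral_has_vector_derivative_AE:
  fixes f :: "real \<Rightarrow> 'a::euclidean_space"
  assumes f: "f integrable_on {a..b}"
  shows "AE x in lebesgue. x \<in> {a<..<b} \<longrightarrow> ((\<lambda>x. integral {a..x} f) has_vector_derivative f x) (at x)"
proof -
  define bad where "bad = (\<lambda>e x u v. a \<le> u \<and> u \<le> x \<and> x \<le> v \<and> v \<le> b \<and> u < v \<and>
                     e * (v - u) < norm ((v - u) *\<^sub>R f x - integral {u..v} f))"
  define S where "S = (\<lambda>n::nat. {x. \<forall>d>0. \<exists>u v. v - u < d \<and> bad (inverse (real (Suc n))) x u v})"
  have "negligible (S n)" for n
    unfolding S_def bad_def using negligible_bad_difference_quotients[OF f, of "inverse (real (Suc n))"] by simp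
  then have "negligible (\<Union>n. S n)" by (intro negligible_Union_nat) auto
  moreover have "((\<lambda>x. integral {a..x} f) has_vector_derivative f x) (at x)"
    if x: "x \<in> {a<..<b}" "x \<notin> (\<Union>n. S n)" for x
    unfolding has_vector_derivative_def has_derivative_at_alt
  proof (intro conjI allI impI)
    show "bounded_linear (\<lambda>h. h *\<^sub>R f x)" by (rule bounded_linear_scaleR_left)
    fix e :: real assume "e > 0"
    then obtain n where n: "inverse (real (Suc n)) < e" using reals_Archimedean by blast
    have "x \<notin> S n" using x by auto
    then obtain d where d: "d > 0" "\<And>u v. v - u < d \<Longrightarrow> \<not> bad (inverse (real (Suc n))) x u v"
      by (auto simp: S_def)
    have good: "norm ((v - u) *\<^sub>R f x - integral {u..v} f) \<le> e * (v - u)"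
      if "v - u < d" "a \<le> u" "u \<le> x" "x \<le> v" "v \<le> b" for u v
    proof (cases "u < v")
      case True
      then have "norm ((v - u) *\<^sub>R f x - integral {u..v} f) \<le> inverse (real (Suc n)) * (v - u)"
        using d(2)[of v u] that by (auto simp: bad_def not_less)
      also have "\<dots> \<le> e * (v - u)" using n True by (intro mult_right_mono) auto
      finally show ?thesis .
    next
      case False
      then have "v = u" using that by simp
      then show ?thesis by simp
    qed
    show "\<exists>d>0. \<forall>y. norm (y - x) < d \<longrightarrow>
        norm (integral {a..y} f - integral {a..x} f - (y - x) *\<^sub>R f x) \<le> e * norm (y - x)"
    proof (intro exI[of _ "min d (min (x - a) (b - x))"] conjI allI impI)
      show "min d (min (x - a) (b - x)) > 0" using d x by auto
      fix y assume y: "norm (y - x) < min d (min (x - a) (b - x))"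
      show "norm (integral {a..y} f - integral {a..x} f - (y - x) *\<^sub>R f x) \<le> e * norm (y - x)"
      proof (cases "x \<le> y")
        case True
        have "integral {a..x} f + integral {x..y} f = integral {a..y} f"
          using y x True by (intro Henstock_Kurzweil_Integration.integral_combine integrable_subinterval_real[OF f]) auto
        then have "integral {a..y} f - integral {a..x} f - (y - x) *\<^sub>R f x = - ((y - x) *\<^sub>R f x - integral {x..y} f)"
          by (simp add: algebra_simps)
        then show ?thesis using good[of y x] y x True by (auto simp: norm_minus_commute)
      next
        case False
        have "integral {a..y} f + integral {y..x} f = integral {a..x} f"
          using y x False by (intro Henstock_Kurzweil_Integration.integral_combine integrable_subinterval_real[OF f]) auto
        then have "integral {a..y} f - integral {a..x} f - (y - x) *\<^sub>R f x = (x - y) *\<^sub>R f x - integral {y..x} f"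
          by (simp add: algebra_simps)
        then show ?thesis using good[of x y] y x False by auto
      qed
    qed
  qed
  ultimately show ?thesis
    by (auto simp: negligible_iff_null_sets intro!: AE_I'[of "\<Union>n. S n"])
qed

section \<open>Absolute continuity of indefinite integrals\<close>

text \<open>At each point at most one of the functions \<open>g I\<close>, the restrictions of
  \<open>\<psi>\<close> to the open intervals, is nonzero, so their sum stays below
  \<open>\<psi>\<close>. Open intervals are used because the closed ones may share endpoints; the
  integrals do not notice the difference.\<close>

lemma sum_integrals_nonoverlapping_le:
  fixes \<psi> :: "real \<Rightarrow> real"
  assumes \<psi>: "\<psi> integrable_on {a..b}" "\<And>x. 0 \<le> \<psi> x"
    and P: "finite P" "\<forall>(c, d)\<in>P. a \<le> c \<and> c \<le> d \<and> d \<le> b"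
      "pairwise (\<lambda>I J. disjnt {fst I<..<snd I} {fst J<..<snd J}) P"
  shows "(\<Sum>(c, d)\<in>P. integral {c..d} \<psi>) \<le> integral {a..b} \<psi>"
proof -
  define g where "g = (\<lambda>I x. if x \<in> {fst I<..<snd I} then \<psi> x else 0)"
  have g: "(g I has_integral integral {fst I..snd I} \<psi>) {a..b}" if "I \<in> P" for I
  proof -
    obtain c d where I: "I = (c, d)" by (cases I)
    have cd: "a \<le> c" "c \<le> d" "d \<le> b" using P that I by auto
    have "(\<psi> has_integral integral {c..d} \<psi>) {c..d}"
      using integrable_subinterval_real[OF \<psi>(1)] cd by (intro integrable_integral) auto
    then have "(\<psi> has_integral integral {c..d} \<psi>) {c<..<d}"
      using has_integral_open_interval[of \<psi> _ c d] by simp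
    then have "((\<lambda>x. if x \<in> {c<..<d} then \<psi> x else 0) has_integral integral {c..d} \<psi>) {a..b}"
      using cd by (subst has_integral_restrict) auto
    then show ?thesis by (simp add: g_def I)
  qed
  have "(\<Sum>I\<in>P. integral {fst I..snd I} \<psi>) = integral {a..b} (\<lambda>x. \<Sum>I\<in>P. g I x)"
    using has_integral_sum[OF P(1), of "\<lambda>I x. g I x", OF g] by (simp add: integral_unique)
  also have "\<dots> \<le> integral {a..b} \<psi>"
  proof (rule integral_le)
    show "(\<lambda>x. \<Sum>I\<in>P. g I x) integrable_on {a..b}"
      using has_integral_sum[OF P(1), of "\<lambda>I x. g I x", OF g] by blast
    show "\<psi> integrable_on {a..b}" by fact
    fix x
    show "(\<Sum>I\<in>P. g I x) \<le> \<psi> x"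
    proof (cases "\<exists>I\<in>P. x \<in> {fst I<..<snd I}")
      case True
      then obtain I where I: "I \<in> P" "x \<in> {fst I<..<snd I}" by blast
      have "g J x = 0" if "J \<in> P - {I}" for J
      proof -
        have "disjnt {fst I<..<snd I} {fst J<..<snd J}" using P(3) I(1) that by (auto simp: pairwise_def)
        then have "x \<notin> {fst J<..<snd J}" using I(2) by (meson disjnt_iff)
        then show ?thesis unfolding g_def by (rule if_not_P)
      qed
      then have "(\<Sum>I\<in>P. g I x) = g I x"
        using I P(1) by (subst sum.remove[of _ I]) (auto intro!: sum.neutral)
      then show ?thesis using \<psi>(2) by (simp add: g_def)
    next
      case False
      then have "(\<Sum>I\<in>P. g I x) = 0" unfolding g_def by (intro sum.neutral ballI if_not_P) blast
      then show ?thesis using \<psi>(2) by simp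
    qed
  qed
  finally show ?thesis by (simp add: case_prod_beta)
qed

text \<open>Truncation at height \<open>M\<close> splits \<open>norm (g x)\<close> into a part
  bounded by \<open>M\<close>, which contributes at most \<open>M\<close> times the total length,
  and an excess whose integral over the whole interval is below \<open>\<epsilon> / 2\<close> for
  large \<open>M\<close> by dominated convergence.\<close>

lemma abs_continuous_on_interval_indefinite_integral:
  fixes g :: "real \<Rightarrow> 'a::euclidean_space"
  assumes g: "g absolutely_integrable_on {a..b}"
    and y: "\<And>x. x \<in> {a..b} \<Longrightarrow> y x = y0 + integral {a..x} g"
  shows "abs_continuous_on_interval a b y"
  unfolding abs_continuous_on_interval_def
proof (intro allI impI)
  fix \<epsilon> :: real assume "\<epsilon> > 0"
  define \<phi> where "\<phi> = (\<lambda>x. norm (g x))"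
  have \<phi>: "\<phi> absolutely_integrable_on {a..b}"
    unfolding \<phi>_def using g by (rule absolutely_integrable_norm[unfolded o_def])
  have cut: "(\<lambda>x. \<phi> x - min (\<phi> x) (real M)) integrable_on {a..b}" for M
  proof -
    have "(\<lambda>x. real M) absolutely_integrable_on {a..b}"
      by (simp add: absolutely_integrable_on_def integrable_const_ivl)
    then have "(\<lambda>x. \<phi> x - min (\<phi> x) (real M)) absolutely_integrable_on {a..b}"
      using absolutely_integrable_min[OF \<phi>] \<phi> by (intro set_integral_diff(1)) auto
    then show ?thesis by (simp add: absolutely_integrable_on_def)
  qed
  have "(\<lambda>M. integral {a..b} (\<lambda>x. \<phi> x - min (\<phi> x) (real M))) \<longlonglongrightarrow> integral {a..b} (\<lambda>x. 0)"
  proof (rule dominated_convergence(2))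
    show "\<phi> integrable_on {a..b}" using \<phi> set_lebesgue_integral_eq_integral(1) by blast
    show "norm (\<phi> x - min (\<phi> x) (real M)) \<le> \<phi> x" for M x by (auto simp: \<phi>_def)
    show "(\<lambda>M. \<phi> x - min (\<phi> x) (real M)) \<longlonglongrightarrow> 0" for x
    proof (rule tendsto_eventually)
      obtain N where "\<phi> x \<le> real N" using real_arch_simple by blast
      then show "eventually (\<lambda>M. \<phi> x - min (\<phi> x) (real M) = 0) sequentially"
        by (intro eventually_sequentiallyI[of N]) auto
    qed
  qed (rule cut)
  then have "eventually (\<lambda>M. integral {a..b} (\<lambda>x. \<phi> x - min (\<phi> x) (real M)) < \<epsilon> / 2) sequentially"
    using \<open>\<epsilon> > 0\<close> by (intro order_tendstoD) auto
  then obtain M where M: "integral {a..b} (\<lambda>x. \<phi> x - min (\<phi> x) (real M)) < \<epsilon> / 2"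
    by (auto simp: eventually_sequentially)
  show "\<exists>\<delta>>0. \<forall>P :: (real \<times> real) set.
        finite P \<and> (\<forall>(c, d)\<in>P. a \<le> c \<and> c \<le> d \<and> d \<le> b) \<and>
        pairwise (\<lambda>I J. disjnt {fst I<..<snd I} {fst J<..<snd J}) P \<and>
        (\<Sum>(c, d)\<in>P. d - c) < \<delta>
        \<longrightarrow> (\<Sum>(c, d)\<in>P. norm (y d - y c)) < \<epsilon>"
  \<comment> \<open>With this \<open>\<delta>\<close> the truncated part contributes at most
    \<open>\<epsilon> / 2\<close>. The summand 1 keeps the denominator positive when
    \<open>M = 0\<close>.\<close>
  proof (intro exI[of _ "\<epsilon> / (2 * (real M + 1))"] conjI allI impI)
    show "\<epsilon> / (2 * (real M + 1)) > 0" using \<open>\<epsilon> > 0\<close> by simp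
    fix P :: "(real \<times> real) set"
    assume P: "finite P \<and> (\<forall>(c, d)\<in>P. a \<le> c \<and> c \<le> d \<and> d \<le> b) \<and>
        pairwise (\<lambda>I J. disjnt {fst I<..<snd I} {fst J<..<snd J}) P \<and>
        (\<Sum>(c, d)\<in>P. d - c) < \<epsilon> / (2 * (real M + 1))"
    have "norm (y d - y c) \<le> integral {c..d} (\<lambda>x. \<phi> x - min (\<phi> x) (real M)) + real M * (d - c)"
      if "(c, d) \<in> P" for c d
    proof -
      have cd: "a \<le> c" "c \<le> d" "d \<le> b" using P that by auto
      have gi: "g integrable_on {a..d}" "g integrable_on {c..d}"
        using integrable_subinterval_real[OF set_lebesgue_integral_eq_integral(1)[OF g]] cd by auto
      have cuti: "(\<lambda>x. \<phi> x - min (\<phi> x) (real M)) integrable_on {c..d}"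
        using integrable_subinterval_real[OF cut] cd by auto
      have \<phi>i: "\<phi> integrable_on {c..d}"
        using integrable_subinterval_real[OF set_lebesgue_integral_eq_integral(1)[OF \<phi>]] cd by auto
      have "y d - y c = integral {c..d} g"
        using Henstock_Kurzweil_Integration.integral_combine[OF cd(1,2) gi(1)] y[of c] y[of d] cd
        by (simp add: algebra_simps)
      then have "norm (y d - y c) \<le> integral {c..d} \<phi>"
        using integral_norm_bound_integral[OF gi(2) \<phi>i] by (auto simp: \<phi>_def)
      also have "\<dots> \<le> integral {c..d} (\<lambda>x. (\<phi> x - min (\<phi> x) (real M)) + real M)"
        by (intro integral_le \<phi>i integrable_add cuti) auto
      also have "\<dots> = integral {c..d} (\<lambda>x. \<phi> x - min (\<phi> x) (real M)) + real M * (d - c)"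
        using cuti cd by (subst integral_add) auto
      finally show ?thesis .
    qed
    then have "(\<Sum>(c, d)\<in>P. norm (y d - y c)) \<le>
        (\<Sum>(c, d)\<in>P. integral {c..d} (\<lambda>x. \<phi> x - min (\<phi> x) (real M)) + real M * (d - c))"
      by (intro sum_mono) auto
    also have "\<dots> = (\<Sum>(c, d)\<in>P. integral {c..d} (\<lambda>x. \<phi> x - min (\<phi> x) (real M))) + real M * (\<Sum>(c, d)\<in>P. d - c)"
      by (simp add: case_prod_beta sum.distrib sum_distrib_left)
    also have "\<dots> \<le> integral {a..b} (\<lambda>x. \<phi> x - min (\<phi> x) (real M)) + real M * (\<Sum>(c, d)\<in>P. d - c)"
      using P by (intro add_right_mono sum_integrals_nonoverlapping_le cut) auto
    also have "\<dots> < \<epsilon> / 2 + real M * (\<Sum>(c, d)\<in>P. d - c)" using M by simp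
    also have "real M * (\<Sum>(c, d)\<in>P. d - c) \<le> (real M + 1) * (\<epsilon> / (2 * (real M + 1)))"
      using P by (intro mult_mono sum_nonneg) auto
    also have "\<dots> = \<epsilon> / 2" by (simp add: field_simps)
    finally show "(\<Sum>(c, d)\<in>P. norm (y d - y c)) < \<epsilon>" by simp
  qed
qed

section \<open>Integrals with an integrable weight\<close>

text \<open>Fubini's theorem is used on the product of two copies of \<open>lborel\<close>, where
  integrands have to be Borel, whereas \<open>q\<close> is only Lebesgue measurable. Each coordinate
  of \<open>q\<close> agrees almost everywhere with a Borel function, and finitely many coordinates
  have a common exceptional null set.\<close>

lemma absolutely_integrable_borel_representative:
  fixes q :: "real \<Rightarrow> 'a::euclidean_space"
  assumes q: "q absolutely_integrable_on S"
  obtains Q where "Q \<in> borel_measurable borel" "integrable lborel Q"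
    "AE y in lborel. Q y = indicator S y *\<^sub>R q y"
proof -
  define p where "p = (\<lambda>y. indicator S y *\<^sub>R q y)"
  have p: "integrable lebesgue p"
    using q by (simp add: set_integrable_def p_def)
  then have pm: "p \<in> borel_measurable lebesgue" by simp
  have "\<exists>g\<in>borel_measurable lborel. AE y in lborel. p y \<bullet> i = g y" for i
    using pm by (intro completion_ex_borel_measurable_real) simp
  then obtain G where G: "\<And>i. G i \<in> borel_measurable lborel" "\<And>i. AE y in lborel. p y \<bullet> i = G i y"
    by metis
  define Q where "Q = (\<lambda>y. \<Sum>i\<in>Basis. G i y *\<^sub>R (i::'a))"
  have Qm: "Q \<in> borel_measurable lborel" unfolding Q_def using G(1) by simp
  have "AE y in lborel. \<forall>i\<in>Basis. p y \<bullet> i = G i y"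
    using G(2) by (intro AE_finite_allI) auto
  then have Qp: "AE y in lborel. Q y = p y"
  proof eventually_elim
    fix y assume "\<forall>i\<in>Basis. p y \<bullet> i = G i y"
    then have "Q y = (\<Sum>i\<in>Basis. (p y \<bullet> i) *\<^sub>R i)" unfolding Q_def by (intro sum.cong) auto
    then show "Q y = p y" by (simp add: euclidean_representation)
  qed
  have "integrable lebesgue Q \<longleftrightarrow> integrable lebesgue p"
    using measurable_completion[OF Qm] pm AE_completion[OF Qp] by (rule integrable_cong_AE)
  with p have "integrable lebesgue Q" by simp
  then have "integrable lborel Q" using Qm by (simp add: integrable_completion)
  with Qm Qp that show ?thesis by (simp add: p_def)
qed

text \<open>On the rectangle the integrand is dominated by \<open>norm (q y)\<close> times a
  constant, hence jointly integrable. The abstract product covers both \<open>**\<close> and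
  \<open>*v\<close>. The factor \<open>m\<close> is only Borel and bounded because the applications
  cut continuous functions off along lines or multiply them by a sign.\<close>

lemma fubini_weighted:
  fixes q :: "real \<Rightarrow> 'a::euclidean_space" and m :: "real \<Rightarrow> real \<Rightarrow> 'b::euclidean_space"
    and prod :: "'a \<Rightarrow> 'b \<Rightarrow> 'c::euclidean_space"
  assumes prod: "bounded_bilinear prod"
    and q: "q absolutely_integrable_on {a..b}"
    and m: "(\<lambda>(y, z). m y z) \<in> borel_measurable borel"
    and bd: "\<And>y z. y \<in> {a..b} \<Longrightarrow> z \<in> {c..d} \<Longrightarrow> norm (m y z) \<le> B"
  shows "(\<lambda>z. integral {a..b} (\<lambda>y. prod (q y) (m y z))) absolutely_integrable_on {c..d}"
    and "integral {c..d} (\<lambda>z. integral {a..b} (\<lambda>y. prod (q y) (m y z)))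
       = integral {a..b} (\<lambda>y. prod (q y) (integral {c..d} (m y)))"
proof -
  interpret prod: bounded_bilinear prod by fact
  obtain Q where Q: "Q \<in> borel_measurable borel" "integrable lborel Q"
    and Qq: "AE y in lborel. Q y = indicator {a..b} y *\<^sub>R q y"
    using absolutely_integrable_borel_representative[OF q] .
  obtain K where K: "K \<ge> 0" "\<And>x y. norm (prod x y) \<le> norm x * norm y * K"
    using prod.nonneg_bounded by blast
  define M where "M = (\<lambda>y z. if y \<in> {a..b} \<and> z \<in> {c..d} then m y z else 0)"
  define f where "f = (\<lambda>y z. prod (Q y) (M y z))"
  have m2[measurable]: "(\<lambda>p. m (fst p) (snd p)) \<in> borel_measurable (borel \<Otimes>\<^sub>M borel)"
    using m by (simp add: case_prod_beta' borel_prod)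
  note Q(1)[measurable]
  have Mm[measurable]: "(\<lambda>p. M (fst p) (snd p)) \<in> borel_measurable (borel \<Otimes>\<^sub>M borel)"
    unfolding M_def by measurable
  have fm: "(\<lambda>p. f (fst p) (snd p)) \<in> borel_measurable (lborel \<Otimes>\<^sub>M lborel)"
    unfolding f_def
  proof (rule borel_measurable_continuous_Pair[where H = prod])
    show "continuous_on UNIV (\<lambda>x. prod (fst x) (snd x))"
      by (intro prod.continuous_on continuous_intros)
  qed measurable
  have Mb: "norm (M y z) \<le> \<bar>B\<bar> * indicator {c..d} z" for y z
    using bd[of y z] by (auto simp: M_def indicator_def)
  have fb: "norm (f y z) \<le> norm (Q y) * (\<bar>B\<bar> * indicator {c..d} z) * K" for y z
    unfolding f_def using K(1)
    by (intro order_trans[OF K(2)] mult_right_mono mult_left_mono Mb) auto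
  define g where "g = (\<lambda>p :: real \<times> real. norm (Q (fst p)) * (\<bar>B\<bar> * indicator {c..d} (snd p)) * K)"
  have ind: "integrable lborel (indicat_real {c..d})"
    by (intro integrable_real_indicator) (auto simp: emeasure_lborel_Icc_eq)
  have gi: "integrable (lborel \<Otimes>\<^sub>M lborel) g"
  proof (rule lborel_pair.Fubini_integrable)
    show "g \<in> borel_measurable (lborel \<Otimes>\<^sub>M lborel)" unfolding g_def by measurable
    show "AE x in lborel. integrable lborel (\<lambda>y. g (x, y))" unfolding g_def using ind by simp
    have "(\<lambda>x. LINT y|lborel. norm (g (x, y))) = (\<lambda>x. norm (Q x) * (\<bar>B\<bar> * measure lborel {c..d} * K))"
      using K(1) by (auto simp: g_def abs_mult algebra_simps)
    then show "integrable lborel (\<lambda>x. LINT y|lborel. norm (g (x, y)))" using Q(2) by simp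
  qed
  have fi: "integrable (lborel \<Otimes>\<^sub>M lborel) (case_prod f)"
  proof (rule Bochner_Integration.integrable_bound[OF gi])
    show "case_prod f \<in> borel_measurable (lborel \<Otimes>\<^sub>M lborel)"
      using fm by (simp only: case_prod_beta')
    have "norm (case_prod f p) \<le> norm (g p)" for p
      using order_trans[OF fb abs_ge_self, of "fst p" "snd p"] by (simp only: case_prod_beta' g_def real_norm_def)
    then show "AE p in lborel \<Otimes>\<^sub>M lborel. norm (case_prod f p) \<le> norm (g p)" by simp
  qed
  \<comment> \<open>Passing from \<open>q\<close> to its Borel version changes the integrand on a
    null set of \<open>y\<close>. After integration in \<open>y\<close> nothing of this remains, so
    the identity holds for every \<open>z\<close>; for the integral over \<open>z\<close> in
    \<open>qfz\<close> it is claimed for almost every \<open>y\<close> only.\<close>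
  have qfy: "integral {a..b} (\<lambda>y. prod (q y) (m y z)) = (LINT y|lborel. f y z)" if z: "z \<in> {c..d}" for z
  proof -
    have "integrable lborel (\<lambda>y. f y z)"
    proof (rule Bochner_Integration.integrable_bound)
      show "integrable lborel (\<lambda>y. norm (Q y) * (\<bar>B\<bar> * K))" using Q(2) by simp
      show "(\<lambda>y. f y z) \<in> borel_measurable lborel"
        using measurable_Pair1[OF fm, of z] by simp
      show "AE y in lborel. norm (f y z) \<le> norm (norm (Q y) * (\<bar>B\<bar> * K))"
        using fb[of _ z] z K by (auto simp: abs_mult algebra_simps)
    qed
    then have "((\<lambda>y. f y z) has_integral (LINT y|lborel. f y z)) UNIV"
      by (rule has_integral_integral_lborel)
    then have "((\<lambda>y. if y \<in> {a..b} then prod (q y) (m y z) else 0) has_integral (LINT y|lborel. f y z)) UNIV"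
    proof (rule has_integral_AE[THEN iffD1, rotated])
      show "AE y in lborel. y \<in> UNIV \<longrightarrow> f y z = (if y \<in> {a..b} then prod (q y) (m y z) else 0)"
        using Qq by eventually_elim (use z in \<open>auto simp: f_def M_def prod.zero_right prod.zero_left\<close>)
    qed
    then show ?thesis unfolding has_integral_restrict_UNIV by (simp add: integral_unique)
  qed
  have qfz: "AE y in lborel. (LINT z|lborel. f y z) = (if y \<in> {a..b} then prod (q y) (integral {c..d} (m y)) else 0)"
    using Qq
  proof eventually_elim
    fix y assume Qy: "Q y = indicator {a..b} y *\<^sub>R q y"
    have Mi: "integrable lborel (M y)"
    proof (rule Bochner_Integration.integrable_bound)
      show "integrable lborel (\<lambda>z. \<bar>B\<bar> * indicator {c..d} z :: real)" using ind by simp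
      show "M y \<in> borel_measurable lborel"
        using measurable_Pair2[OF Mm, of y] by simp
      show "AE z in lborel. norm (M y z) \<le> norm (\<bar>B\<bar> * indicator {c..d} z :: real)"
        using Mb[of y] by (auto simp: abs_mult)
    qed
    have "(LINT z|lborel. f y z) = prod (Q y) (LINT z|lborel. M y z)"
      unfolding f_def by (rule integral_bounded_linear[OF prod.bounded_linear_right Mi])
    also have "\<dots> = (if y \<in> {a..b} then prod (q y) (integral {c..d} (m y)) else 0)"
    proof (cases "y \<in> {a..b}")
      case True
      have "((\<lambda>z. if z \<in> {c..d} then m y z else 0) has_integral (LINT z|lborel. M y z)) UNIV"
        using has_integral_integral_lborel[OF Mi] True by (simp add: M_def)
      then show ?thesis using True Qy unfolding has_integral_restrict_UNIV by (simp add: integral_unique)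
    qed (auto simp: Qy prod.zero_left)
    finally show "(LINT z|lborel. f y z) = (if y \<in> {a..b} then prod (q y) (integral {c..d} (m y)) else 0)" .
  qed
  have sndi: "integrable lborel (\<lambda>z. LINT y|lborel. f y z)"
    by (rule lborel_pair.integrable_snd[OF fi])
  have fsti: "integrable lborel (\<lambda>y. LINT z|lborel. f y z)"
    by (rule lborel_pair.integrable_fst[OF fi])
  have out: "(LINT y|lborel. f y z) = 0" if "z \<notin> {c..d}" for z
    using that by (auto simp: f_def M_def prod.zero_right)
  have eq: "(\<lambda>z. indicator {c..d} z *\<^sub>R integral {a..b} (\<lambda>y. prod (q y) (m y z))) = (\<lambda>z. LINT y|lborel. f y z)"
    using qfy out by (auto simp: fun_eq_iff indicator_def)
  show 1: "(\<lambda>z. integral {a..b} (\<lambda>y. prod (q y) (m y z))) absolutely_integrable_on {c..d}"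
    unfolding set_integrable_def eq using sndi by (simp add: integrable_completion)
  have "integral {c..d} (\<lambda>z. integral {a..b} (\<lambda>y. prod (q y) (m y z))) = (LINT z|lborel. LINT y|lborel. f y z)"
  proof -
    have "(\<lambda>z. LINT y|lborel. f y z) = (\<lambda>z. if z \<in> {c..d} then integral {a..b} (\<lambda>y. prod (q y) (m y z)) else 0)"
      using qfy out by (simp add: fun_eq_iff)
    then have "((\<lambda>z. if z \<in> {c..d} then integral {a..b} (\<lambda>y. prod (q y) (m y z)) else 0)
        has_integral (LINT z|lborel. LINT y|lborel. f y z)) UNIV"
      using has_integral_integral_lborel[OF sndi] by simp
    then show ?thesis unfolding has_integral_restrict_UNIV by (simp add: integral_unique)
  qed
  also have "\<dots> = (LINT y|lborel. LINT z|lborel. f y z)"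
    by (rule lborel_pair.Fubini_integral[OF fi])
  also have "\<dots> = integral {a..b} (\<lambda>y. prod (q y) (integral {c..d} (m y)))"
  proof -
    have "((\<lambda>y. if y \<in> {a..b} then prod (q y) (integral {c..d} (m y)) else 0)
        has_integral (LINT y|lborel. LINT z|lborel. f y z)) UNIV"
      using has_integral_AE[THEN iffD1, OF _ has_integral_integral_lborel[OF fsti]] qfz by simp
    then show ?thesis unfolding has_integral_restrict_UNIV by (simp add: integral_unique)
  qed
  finally show "integral {c..d} (\<lambda>z. integral {a..b} (\<lambda>y. prod (q y) (m y z)))
       = integral {a..b} (\<lambda>y. prod (q y) (integral {c..d} (m y)))" .
qed

lemma absolutely_integrable_continuous_product:
  fixes q :: "real \<Rightarrow> 'a::euclidean_space" and m :: "real \<Rightarrow> 'b::euclidean_space"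
    and prod :: "'a \<Rightarrow> 'b \<Rightarrow> 'c::euclidean_space"
  assumes prod: "bounded_bilinear prod"
    and q: "q absolutely_integrable_on {a..b}" and m: "continuous_on {a..b} m"
  shows "(\<lambda>y. prod (q y) (m y)) absolutely_integrable_on {a..b}"
proof (rule absolutely_integrable_bounded_measurable_product[of "\<lambda>x y. prod y x"])
  show "bilinear (\<lambda>x y. prod y x)"
    using bounded_bilinear.flip[OF prod] by (simp add: bilinear_conv_bounded_bilinear)
  show "m \<in> borel_measurable (lebesgue_on {a..b})"
    using m by (intro continuous_imp_measurable_on_sets_lebesgue) auto
  show "bounded (m ` {a..b})"
    using m by (intro compact_imp_bounded compact_continuous_image) auto
qed (use q in auto)

lemma norm_integral_product_le:
  fixes q :: "real \<Rightarrow> 'a::euclidean_space" and m :: "real \<Rightarrow> 'b::euclidean_space"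
    and prod :: "'a \<Rightarrow> 'b \<Rightarrow> 'c::euclidean_space"
  assumes prod: "bounded_bilinear prod"
    and q: "q absolutely_integrable_on {a..b}" and m: "continuous_on {a..b} m"
    and K: "\<And>x y. norm (prod x y) \<le> norm x * norm y * K" "K \<ge> 0"
    and B: "\<And>y. y \<in> {a..b} \<Longrightarrow> norm (m y) \<le> B"
  shows "norm (integral {a..b} (\<lambda>y. prod (q y) (m y))) \<le> integral {a..b} (\<lambda>y. norm (q y)) * B * K"
proof -
  have qn: "(\<lambda>y. norm (q y)) integrable_on {a..b}"
    using q by (simp add: absolutely_integrable_on_def)
  have "norm (integral {a..b} (\<lambda>y. prod (q y) (m y))) \<le> integral {a..b} (\<lambda>y. norm (q y) * (B * K))"
  proof (rule integral_norm_bound_integral)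
    show "(\<lambda>y. prod (q y) (m y)) integrable_on {a..b}"
      using absolutely_integrable_continuous_product[OF prod q m] by (simp add: absolutely_integrable_on_def)
    show "(\<lambda>y. norm (q y) * (B * K)) integrable_on {a..b}" using qn by (rule integrable_on_mult_left)
    fix y assume "y \<in> {a..b}"
    then have "norm (q y) * norm (m y) * K \<le> norm (q y) * B * K"
      using B K by (intro mult_right_mono mult_left_mono) auto
    then show "norm (prod (q y) (m y)) \<le> norm (q y) * (B * K)"
      using K(1)[of "q y" "m y"] by (simp add: mult.assoc)
  qed
  then show ?thesis by (simp add: mult.assoc)
qed

text \<open>Dominated convergence along sequences tending to \<open>p\<close>: on the compact set
  \<open>{a..b} \<times> cball p 1\<close> the factor \<open>m\<close> is bounded, and this bound
  times \<open>norm (q y)\<close> and the constant of the product is an integrable majorant.\<close>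

lemma continuous_on_integral_product:
  fixes q :: "real \<Rightarrow> 'a::euclidean_space" and m :: "real \<Rightarrow> 'p::euclidean_space \<Rightarrow> 'b::euclidean_space"
    and prod :: "'a \<Rightarrow> 'b \<Rightarrow> 'c::euclidean_space"
  assumes prod: "bounded_bilinear prod"
    and q: "q absolutely_integrable_on {a..b}" and m: "continuous_on UNIV (\<lambda>(y, p). m y p)"
  shows "continuous_on UNIV (\<lambda>p. integral {a..b} (\<lambda>y. prod (q y) (m y p)))"
proof (rule continuous_at_imp_continuous_on, rule ballI)
  interpret prod: bounded_bilinear prod by fact
  obtain K where K: "K \<ge> 0" "\<And>x y. norm (prod x y) \<le> norm x * norm y * K"
    using prod.nonneg_bounded by blast
  fix p :: 'p
  have "compact ({a..b} \<times> cball p 1)" by (intro compact_Times) auto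
  then have "bounded ((\<lambda>(y, p). m y p) ` ({a..b} \<times> cball p 1))"
    by (intro compact_imp_bounded compact_continuous_image continuous_on_subset[OF m]) auto
  then obtain B where "\<forall>x\<in>(\<lambda>(y, p). m y p) ` ({a..b} \<times> cball p 1). norm x \<le> B"
    using bounded_iff by metis
  then have B: "norm (m y p') \<le> B" if "y \<in> {a..b}" "p' \<in> cball p 1" for y p'
    using that by (metis (no_types, lifting) case_prod_conv image_eqI mem_Sigma_iff)
  have mc: "continuous_on {a..b} (\<lambda>y. m y p')" for p'
    using continuous_on_compose2[OF m, of "{a..b}" "\<lambda>y. (y, p')"] by (simp add: continuous_intros)
  have qm: "(\<lambda>y. prod (q y) (m y p')) integrable_on {a..b}" for p'
    using absolutely_integrable_continuous_product[OF prod q mc] by (simp add: absolutely_integrable_on_def)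
  show "isCont (\<lambda>p. integral {a..b} (\<lambda>y. prod (q y) (m y p))) p"
    unfolding continuous_at_sequentially comp_def
  proof (intro allI impI)
    fix X :: "nat \<Rightarrow> 'p" assume X: "X \<longlonglongrightarrow> p"
    then have "eventually (\<lambda>n. X n \<in> ball p 1) sequentially"
      by (intro topological_tendstoD) auto
    then obtain N where N: "\<And>n. n \<ge> N \<Longrightarrow> X n \<in> ball p 1" by (auto simp: eventually_sequentially)
    have "(\<lambda>n. integral {a..b} (\<lambda>y. prod (q y) (m y (X (n + N))))) \<longlonglongrightarrow> integral {a..b} (\<lambda>y. prod (q y) (m y p))"
    proof (rule dominated_convergence(2)[OF qm])
      show "(\<lambda>y. norm (q y) * (B * K)) integrable_on {a..b}"
        using q by (intro integrable_on_mult_left) (simp add: absolutely_integrable_on_def)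
      fix n y assume y: "y \<in> {a..b}"
      have "norm (m y (X (n + N))) \<le> B" using N[of "n + N"] y by (intro B) (auto simp: less_imp_le)
      then have "norm (q y) * norm (m y (X (n + N))) * K \<le> norm (q y) * B * K"
        using K by (intro mult_right_mono mult_left_mono) auto
      then show "norm (prod (q y) (m y (X (n + N)))) \<le> norm (q y) * (B * K)"
        using K(2)[of "q y" "m y (X (n + N))"] by (simp add: mult.assoc)
    next
      fix y assume y: "y \<in> {a..b}"
      have "continuous_on UNIV (\<lambda>p. m y p)"
        using continuous_on_compose2[OF m, of UNIV "\<lambda>p. (y, p)"] by (simp add: continuous_intros)
      then have "isCont (\<lambda>p. m y p) p" by (simp add: continuous_on_eq_continuous_at)
      then have "(\<lambda>n. m y (X (n + N))) \<longlonglongrightarrow> m y p"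
        using LIMSEQ_ignore_initial_segment[OF X, of N] isCont_tendsto_compose by blast
      then show "(\<lambda>n. prod (q y) (m y (X (n + N)))) \<longlonglongrightarrow> prod (q y) (m y p)"
        by (intro prod.tendsto tendsto_const)
    qed
    then show "(\<lambda>n. integral {a..b} (\<lambda>y. prod (q y) (m y (X n)))) \<longlonglongrightarrow> integral {a..b} (\<lambda>y. prod (q y) (m y p))"
      by (rule LIMSEQ_offset)
  qed
qed

text \<open>The substitution z = b p * s moves the parameter from the limit of integration into the
  integrand over the fixed interval from 0 to 1. Replacing \<open>b p\<close> by
  \<open>max 0 (b p)\<close> accounts for negative limits, where the interval is empty.\<close>

lemma continuous_on_integral_upto:
  fixes G :: "'p::topological_space \<Rightarrow> real \<Rightarrow> 'a::banach"
  assumes G: "continuous_on UNIV (\<lambda>(p, z). G p z)" and b: "continuous_on UNIV b"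
  shows "continuous_on UNIV (\<lambda>p. integral {0..b p} (G p))"
proof -
  have "integral {0..b p} (G p) = max 0 (b p) *\<^sub>R integral (cbox 0 1) (\<lambda>s. G p (max 0 (b p) * s))" for p
  proof (cases "b p > 0")
    case True
    have "continuous_on {0..b p} (G p)"
      using continuous_on_compose2[OF G, of "{0..b p}" "\<lambda>z. (p, z)"] by (simp add: continuous_intros)
    then have "(G p has_integral integral {0..b p} (G p)) (cbox 0 (b p))"
      by (simp add: integrable_continuous_interval integrable_integral)
    from has_integral_affinity'[OF this True, of 0]
    have "((\<lambda>s. G p (b p * s)) has_integral (integral {0..b p} (G p) /\<^sub>R b p)) (cbox 0 1)"
      using True by simp
    then show ?thesis using True by (simp add: integral_unique)
  qed (auto simp: integral_eq_0_iff not_less max_def)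
  moreover have "continuous_on UNIV (\<lambda>p. integral (cbox 0 1) (\<lambda>s. G p (max 0 (b p) * s)))"
  proof (rule integral_continuous_on_param)
    have "continuous_on (UNIV \<times> cbox 0 1) (\<lambda>x::'p \<times> real. max 0 (b (fst x)) * snd x)"
      by (intro continuous_intros continuous_on_compose2[OF b]) auto
    then have "continuous_on (UNIV \<times> cbox 0 1) (\<lambda>x::'p \<times> real. (fst x, max 0 (b (fst x)) * snd x))"
      by (intro continuous_on_Pair continuous_on_fst continuous_on_id)
    from continuous_on_compose2[OF G this]
    show "continuous_on (UNIV \<times> cbox 0 1) (\<lambda>(p, s). G p (max 0 (b p) * s))"
      by (simp add: split_beta)
  qed
  ultimately show ?thesis using b by (simp add: continuous_intros)
qed

section \<open>The Goursat problem\<close>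

lemma bounded_bilinear_matrix_matrix_mult:
  "bounded_bilinear ((**) :: complex^'n^'m \<Rightarrow> complex^'k^'n \<Rightarrow> complex^'k^'m)"
  unfolding bilinear_conv_bounded_bilinear[symmetric] bilinear_def linear_iff
  by (simp add: matrix_matrix_mult_def vec_eq_iff sum.distrib distrib_left distrib_right scaleR_sum_right)

lemma bounded_bilinear_matrix_vector_mult:
  "bounded_bilinear ((*v) :: complex^'n^'m \<Rightarrow> complex^'n \<Rightarrow> complex^'m)"
  unfolding bilinear_conv_bounded_bilinear[symmetric] bilinear_def linear_iff
  by (simp add: matrix_vector_mult_def vec_eq_iff sum.distrib distrib_left distrib_right scaleR_sum_right)

text \<open>Continuity is required on the whole plane. Functions that matter only on the quadrant
  are extended by evaluating them at \<open>max 0 x\<close> and \<open>max 0 s\<close>, so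
  compositions need no conditions on where the arguments lie.\<close>

abbreviation cont2 :: "(real \<Rightarrow> real \<Rightarrow> 'a::topological_space) \<Rightarrow> bool" where
  "cont2 V \<equiv> continuous_on UNIV (\<lambda>(y, z). V y z)"

lemma continuous_on_cont2:
  assumes "cont2 V" "continuous_on S f" "continuous_on S g"
  shows "continuous_on S (\<lambda>x. V (f x) (g x))"
  using continuous_on_compose2[OF assms(1) continuous_on_Pair[OF assms(2,3)]] by simp

lemma bounded_cont2:
  fixes V :: "real \<Rightarrow> real \<Rightarrow> 'a::real_normed_vector"
  assumes "cont2 V"
  obtains B where "\<And>y z. y \<in> {a..b} \<Longrightarrow> z \<in> {c..d} \<Longrightarrow> norm (V y z) \<le> B"
proof -
  have "bounded ((\<lambda>(y, z). V y z) ` ({a..b} \<times> {c..d}))"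
    by (intro compact_imp_bounded compact_continuous_image continuous_on_subset[OF assms] compact_Times) auto
  then obtain B where B: "\<forall>w\<in>(\<lambda>(y, z). V y z) ` ({a..b} \<times> {c..d}). norm w \<le> B"
    unfolding bounded_iff by blast
  show thesis
  proof (rule that)
    fix y z assume "y \<in> {a..b}" "z \<in> {c..d}"
    then have "V y z \<in> (\<lambda>(y, z). V y z) ` ({a..b} \<times> {c..d})"
      by (intro image_eqI[of _ _ "(y, z)"]) simp_all
    with B show "norm (V y z) \<le> B" by (rule bspec)
  qed
qed

text \<open>Used where a formula with fixed limits of integration, or uniform convergence, is
  available on bounded sets only.\<close>

lemma continuous_on_UNIV_balls:
  fixes f :: "'a::real_normed_vector \<Rightarrow> 'b::topological_space"
  assumes "\<And>R. continuous_on (ball 0 R) f"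
  shows "continuous_on UNIV f"
proof -
  have "continuous_on (\<Union>R\<in>UNIV. ball 0 R) f"
    by (intro continuous_on_open_UN assms) auto
  moreover have "(\<Union>R\<in>UNIV. ball 0 R) = (UNIV :: 'a set)"
  proof -
    have "x \<in> (\<Union>R. ball 0 R)" for x :: 'a
      by (rule UN_I[of "norm x + 1"]) simp_all
    then show ?thesis by blast
  qed
  ultimately show ?thesis by simp
qed

lemma L1_locD: "L1_loc q \<Longrightarrow> q absolutely_integrable_on {0..T}"
proof (cases "T > 0")
  case False
  then have "{0..T} \<subseteq> {0}" by auto
  then show ?thesis by (intro absolutely_integrable_negligible negligible_subset[OF negligible_sing])
qed (simp add: L1_loc_def)

lemma L1_loc_integrable:
  assumes "L1_loc q" "0 \<le> a"
  shows "q integrable_on {a..b}"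
proof (rule integrable_subinterval_real)
  show "q integrable_on {0..b}" using L1_locD[OF assms(1)] by (simp add: absolutely_integrable_on_def)
qed (use assms in auto)

section \<open>The Goursat equation in the coordinates x and s\<close>

definition primitive :: "(real \<Rightarrow> real \<Rightarrow> 'a::banach) \<Rightarrow> real \<Rightarrow> real \<Rightarrow> 'a" where
  "primitive V y z = integral {0..z} (V y)"

lemma primitive_nonpos: "z \<le> 0 \<Longrightarrow> primitive V y z = 0"
  by (cases "z = 0") (auto simp: primitive_def)

lemma cont2_primitive: "cont2 V \<Longrightarrow> cont2 (primitive V)"
proof -
  assume V: "cont2 V"
  have "continuous_on UNIV (\<lambda>p. integral {0..snd p} (V (fst p)))"
    by (rule continuous_on_integral_upto)
      (auto simp: split_beta intro!: continuous_on_cont2[OF V] continuous_intros)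
  then show ?thesis by (simp add: primitive_def split_beta)
qed

text \<open>With \<xi> = s and \<eta> = s + 2 x, the rectangle of the Goursat equation becomes 0
  \<le> z \<le> s, s \<le> z + 2 y \<le> s + 2 x in the variables y = (\<eta>1 - \<xi>1) / 2 and z =
  \<xi>1. For nonnegative \<open>x\<close> and \<open>y\<close> this is the integral of
  \<open>V y\<close> over the slice at \<open>y\<close>. Written as a difference of primitives it is
  visibly continuous in all variables.\<close>

definition strip :: "(real \<Rightarrow> real \<Rightarrow> 'a::banach) \<Rightarrow> real \<Rightarrow> real \<Rightarrow> real \<Rightarrow> 'a" where
  "strip V x s y = primitive V y (min s (s + 2 * x - 2 * y)) - primitive V y (s - 2 * y)"

lemma continuous_strip:
  assumes "cont2 V"
  shows "continuous_on UNIV (\<lambda>(y, p). strip V (fst p) (snd p) y)"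
  unfolding strip_def split_beta
  by (intro continuous_intros continuous_on_cont2[OF cont2_primitive[OF assms]])

lemma continuous_strip_section:
  assumes "cont2 V"
  shows "continuous_on S (strip V x s)"
  unfolding strip_def[abs_def]
  by (intro continuous_intros continuous_on_cont2[OF cont2_primitive[OF assms]])

lemma strip_eq_0: "0 \<le> x \<Longrightarrow> x + s / 2 \<le> y \<Longrightarrow> strip V x s y = 0"
  by (simp add: strip_def primitive_nonpos)

lemma strip_eq_integral:
  assumes V: "cont2 V" and "0 \<le> x" "0 \<le> y"
  shows "strip V x s y = integral {max 0 (s - 2 * y)..min s (s + 2 * x - 2 * y)} (V y)"
proof -
  let ?l = "s - 2 * y" and ?u = "min s (s + 2 * x - 2 * y)"
  have lu: "?l \<le> ?u" using assms by auto
  have cV: "continuous_on S (V y)" for S using continuous_on_cont2[OF V, of S "\<lambda>_. y" "\<lambda>z. z"] by simp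
  consider "?u \<le> 0" | "?u > 0" "?l \<le> 0" | "?l > 0" by linarith
  then show ?thesis
  proof cases
    case 1
    then have "{max 0 ?l..?u} = {} \<or> {max 0 ?l..?u} = {0}" using lu by auto
    moreover have "strip V x s y = 0"
      unfolding strip_def primitive_nonpos[OF 1] primitive_nonpos[OF order_trans[OF lu 1]] by simp
    ultimately show ?thesis by auto
  next
    case 2
    then show ?thesis by (simp add: strip_def primitive_nonpos) (simp add: primitive_def max_def)
  next
    case 3
    have "integral {0..?l} (V y) + integral {?l..?u} (V y) = integral {0..?u} (V y)"
      using 3 lu cV by (intro Henstock_Kurzweil_Integration.integral_combine integrable_continuous_interval) auto
    then show ?thesis using 3 by (simp add: strip_def primitive_def max_def algebra_simps)
  qed
qed

definition goursat_source :: "(real \<Rightarrow> complex^'n^'n) \<Rightarrow> real \<Rightarrow> real \<Rightarrow> complex^'n^'n" where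
  "goursat_source q x s = - ((1/2) *\<^sub>R integral {s / 2..s / 2 + x} q)"

text \<open>The factor 1/2 is the 1/4 of the Goursat equation times the Jacobian 2 of the
  substitution y = (\<eta>1 - \<xi>1) / 2. The upper limit is \<eta> / 2, beyond which the slices
  are empty.\<close>

definition goursat_operator ::
  "(real \<Rightarrow> complex^'n^'n) \<Rightarrow> (real \<Rightarrow> real \<Rightarrow> complex^'n^'n) \<Rightarrow> real \<Rightarrow> real \<Rightarrow> complex^'n^'n" where
  "goursat_operator q V x s = (1/2) *\<^sub>R integral {0..x + s / 2} (\<lambda>y. q y ** strip V x s y)"

lemma integrable_goursat_operator:
  fixes q :: "real \<Rightarrow> complex^'n^'n" and V :: "real \<Rightarrow> real \<Rightarrow> complex^'n^'n"
  assumes "L1_loc q" "cont2 V"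
  shows "(\<lambda>y. q y ** strip V x s y) integrable_on {0..T}"
  using absolutely_integrable_continuous_product[OF bounded_bilinear_matrix_matrix_mult L1_locD[OF assms(1)]
      continuous_strip_section[OF assms(2)]]
  by (simp add: absolutely_integrable_on_def)

text \<open>The strip vanishes for \<open>y\<close> beyond \<open>x + s / 2\<close>, so the upper
  limit may be frozen. This makes the range of integration independent of the parameters, as
  continuity in \<open>x\<close>, \<open>s\<close> and Fubini's theorem require.\<close>

lemma goursat_operator_eq:
  fixes q :: "real \<Rightarrow> complex^'n^'n"
  assumes q: "L1_loc q" and V: "cont2 V" and x: "0 \<le> x" and s: "0 \<le> s" and T: "x + s / 2 \<le> T"
  shows "goursat_operator q V x s = (1/2) *\<^sub>R integral {0..T} (\<lambda>y. q y ** strip V x s y)"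
proof -
  interpret m: bounded_bilinear "(**) :: complex^'n^'n \<Rightarrow> complex^'n^'n \<Rightarrow> complex^'n^'n"
    by (rule bounded_bilinear_matrix_matrix_mult)
  have "integral {0..x + s / 2} (\<lambda>y. q y ** strip V x s y) + integral {x + s / 2..T} (\<lambda>y. q y ** strip V x s y)
      = integral {0..T} (\<lambda>y. q y ** strip V x s y)"
    using x s T by (intro Henstock_Kurzweil_Integration.integral_combine integrable_goursat_operator q V) auto
  moreover have "integral {x + s / 2..T} (\<lambda>y. q y ** strip V x s y) = integral {x + s / 2..T} (\<lambda>y. 0)"
    using x by (intro Henstock_Kurzweil_Integration.integral_cong) (simp add: strip_eq_0 m.zero_right)
  ultimately show ?thesis by (simp add: goursat_operator_def)
qed

lemma goursat_operator_diff:
  fixes q :: "real \<Rightarrow> complex^'n^'n"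
  assumes q: "L1_loc q" and V: "cont2 V" and W: "cont2 W"
  shows "goursat_operator q V x s - goursat_operator q W x s = goursat_operator q (\<lambda>y z. V y z - W y z) x s"
proof -
  interpret m: bounded_bilinear "(**) :: complex^'n^'n \<Rightarrow> complex^'n^'n \<Rightarrow> complex^'n^'n"
    by (rule bounded_bilinear_matrix_matrix_mult)
  have "primitive (\<lambda>y z. V y z - W y z) y z = primitive V y z - primitive W y z" for y z
    unfolding primitive_def
    using continuous_on_cont2[OF V, of _ "\<lambda>_. y" "\<lambda>z. z"] continuous_on_cont2[OF W, of _ "\<lambda>_. y" "\<lambda>z. z"]
    by (intro Henstock_Kurzweil_Integration.integral_diff integrable_continuous_interval) auto
  then have "strip (\<lambda>y z. V y z - W y z) x s y = strip V x s y - strip W x s y" for y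
    by (simp add: strip_def)
  then show ?thesis
    unfolding goursat_operator_def
    by (simp add: m.diff_right Henstock_Kurzweil_Integration.integral_diff integrable_goursat_operator q V W
        flip: scaleR_right_diff_distrib)
qed

text \<open>The substitution \<open>y = (\<eta>\<^sub>1 - \<xi>\<^sub>1) / 2\<close> followed by an interchange of the two integrals moves the
  merely integrable factor \<open>q\<close> outside, leaving inside an integral of \<open>V\<close> with continuous limits.\<close>

lemma goursat_double_integral:
  fixes q :: "real \<Rightarrow> complex^'n^'n"
  assumes q: "L1_loc q" and V: "cont2 V" and "0 \<le> \<xi>" "\<xi> \<le> \<eta>"
  shows "integral {0..\<xi>} (\<lambda>\<xi>1. integral {\<xi>..\<eta>} (\<lambda>\<eta>1. q ((\<eta>1 - \<xi>1) / 2) ** V ((\<eta>1 - \<xi>1) / 2) \<xi>1))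
       = 4 *\<^sub>R goursat_operator q V ((\<eta> - \<xi>) / 2) \<xi>"
proof -
  interpret mm: bounded_bilinear "(**) :: complex^'n^'n \<Rightarrow> complex^'n^'n \<Rightarrow> complex^'n^'n"
    by (rule bounded_bilinear_matrix_matrix_mult)
  \<comment> \<open>The condition \<xi> \<le> \<eta>1 \<le> \<eta> is encoded as a cut-off of
    \<open>V\<close>, so that both integrals run over fixed intervals.\<close>
  define m where "m = (\<lambda>y z. if \<xi> - 2 * y \<le> z \<and> z \<le> \<eta> - 2 * y then V y z else 0)"
  have inner: "integral {\<xi>..\<eta>} (\<lambda>\<eta>1. q ((\<eta>1 - z) / 2) ** V ((\<eta>1 - z) / 2) z)
      = 2 *\<^sub>R integral {0..\<eta> / 2} (\<lambda>y. q y ** m y z)" if z: "z \<in> {0..\<xi>}" for z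
  proof -
    define \<phi> where "\<phi> = (\<lambda>y. q y ** V y z)"
    let ?J = "{(\<xi> - z) / 2..(\<eta> - z) / 2}"
    have "\<phi> absolutely_integrable_on {0..\<eta> / 2}"
      unfolding \<phi>_def
      by (intro absolutely_integrable_continuous_product[OF bounded_bilinear_matrix_matrix_mult L1_locD[OF q]]
          continuous_on_cont2[OF V] continuous_intros)
    then have \<phi>i: "\<phi> integrable_on {0..\<eta> / 2}" by (simp add: absolutely_integrable_on_def)
    have "\<phi> integrable_on ?J"
      by (rule integrable_subinterval_real[OF \<phi>i]) (use z assms(4) in auto)
    then have J: "(\<phi> has_integral integral ?J \<phi>) (cbox ((\<xi> - z) / 2) ((\<eta> - z) / 2))"
      by (simp add: integrable_integral)
    have "((\<lambda>\<eta>1. \<phi> ((1/2) *\<^sub>R \<eta>1 + (- z / 2))) has_integral (integral ?J \<phi> /\<^sub>R (1/2) ^ DIM(real)))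
        (cbox (((\<xi> - z) / 2 - (- z / 2)) /\<^sub>R (1/2)) (((\<eta> - z) / 2 - (- z / 2)) /\<^sub>R (1/2)))"
      by (rule has_integral_affinity'[OF J]) simp
    then have "((\<lambda>\<eta>1. \<phi> ((\<eta>1 - z) / 2)) has_integral 2 *\<^sub>R integral ?J \<phi>) {\<xi>..\<eta>}"
      by (simp add: diff_divide_distrib)
    then have "integral {\<xi>..\<eta>} (\<lambda>\<eta>1. \<phi> ((\<eta>1 - z) / 2)) = 2 *\<^sub>R integral ?J \<phi>" by (rule integral_unique)
    moreover have "integral {0..\<eta> / 2} (\<lambda>y. q y ** m y z) = integral ?J \<phi>"
    proof -
      have "integral {0..\<eta> / 2} (\<lambda>y. q y ** m y z) = integral {0..\<eta> / 2} (\<lambda>y. if y \<in> ?J then \<phi> y else 0)"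
        by (intro Henstock_Kurzweil_Integration.integral_cong) (auto simp: m_def \<phi>_def mm.zero_right)
      also have "\<dots> = integral ({0..\<eta> / 2} \<inter> ?J) \<phi>" by (subst Int_commute, rule Henstock_Kurzweil_Integration.integral_restrict_Int)
      also have "{0..\<eta> / 2} \<inter> ?J = ?J" using z by auto
      finally show ?thesis .
    qed
    ultimately show ?thesis by (simp add: \<phi>_def)
  qed
  obtain B where B: "\<And>y z. y \<in> {0..\<eta> / 2} \<Longrightarrow> z \<in> {0..\<xi>} \<Longrightarrow> norm (V y z) \<le> B"
    using bounded_cont2[OF V] by metis
  have m_bound: "norm (m y z) \<le> \<bar>B\<bar>" if "y \<in> {0..\<eta> / 2}" "z \<in> {0..\<xi>}" for y z
    using order_trans[OF B[OF that] abs_ge_self] by (simp add: m_def)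
  have m_borel: "(\<lambda>(y, z). m y z) \<in> borel_measurable borel"
  proof -
    have "closed {p :: real \<times> real. \<xi> - 2 * fst p \<le> snd p \<and> snd p \<le> \<eta> - 2 * fst p}"
      by (intro closed_Collect_conj closed_Collect_le continuous_intros)
    then have "{p \<in> space borel. \<xi> - 2 * fst p \<le> snd p \<and> snd p \<le> \<eta> - 2 * fst p} \<in> sets borel"
      by (simp add: borel_closed)
    then have "(\<lambda>p. if \<xi> - 2 * fst p \<le> snd p \<and> snd p \<le> \<eta> - 2 * fst p then V (fst p) (snd p) else 0)
        \<in> borel_measurable (borel :: (real \<times> real) measure)"
      using V by (intro measurable_If borel_measurable_continuous_onI) (simp_all add: split_beta')
    then show ?thesis by (simp add: m_def split_beta')
  qed
  have m_int: "integral {0..\<xi>} (m y) = strip V ((\<eta> - \<xi>) / 2) \<xi> y" if y: "y \<in> {0..\<eta> / 2}" for y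
  proof -
    have "integral {0..\<xi>} (m y) = integral {0..\<xi>} (\<lambda>z. if z \<in> {\<xi> - 2 * y..\<eta> - 2 * y} then V y z else 0)"
      by (simp add: m_def)
    also have "\<dots> = integral ({0..\<xi>} \<inter> {\<xi> - 2 * y..\<eta> - 2 * y}) (V y)" by (subst Int_commute, rule Henstock_Kurzweil_Integration.integral_restrict_Int)
    also have "{0..\<xi>} \<inter> {\<xi> - 2 * y..\<eta> - 2 * y} = {max 0 (\<xi> - 2 * y)..min \<xi> (\<xi> + 2 * ((\<eta> - \<xi>) / 2) - 2 * y)}"
      by (auto simp: field_simps)
    also have "integral \<dots> (V y) = strip V ((\<eta> - \<xi>) / 2) \<xi> y"
      using y assms(4) by (intro strip_eq_integral[OF V, symmetric]) auto
    finally show ?thesis .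
  qed
  have "integral {0..\<xi>} (\<lambda>\<xi>1. integral {\<xi>..\<eta>} (\<lambda>\<eta>1. q ((\<eta>1 - \<xi>1) / 2) ** V ((\<eta>1 - \<xi>1) / 2) \<xi>1))
      = integral {0..\<xi>} (\<lambda>z. 2 *\<^sub>R integral {0..\<eta> / 2} (\<lambda>y. q y ** m y z))"
    by (intro Henstock_Kurzweil_Integration.integral_cong inner)
  also have "\<dots> = 2 *\<^sub>R integral {0..\<eta> / 2} (\<lambda>y. q y ** integral {0..\<xi>} (m y))"
    using fubini_weighted(2)[OF bounded_bilinear_matrix_matrix_mult L1_locD[OF q] m_borel m_bound] by simp
  also have "integral {0..\<eta> / 2} (\<lambda>y. q y ** integral {0..\<xi>} (m y))
      = integral {0..\<eta> / 2} (\<lambda>y. q y ** strip V ((\<eta> - \<xi>) / 2) \<xi> y)"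
    by (intro Henstock_Kurzweil_Integration.integral_cong) (simp add: m_int)
  also have "2 *\<^sub>R \<dots> = 4 *\<^sub>R goursat_operator q V ((\<eta> - \<xi>) / 2) \<xi>"
    by (simp add: goursat_operator_def diff_divide_distrib)
  finally show ?thesis .
qed

text \<open>The map from (x, s) to (\<xi>, \<eta>) = (s, s + 2 x) carries the quadrant onto the
  region. The rectangle of integration lies in the region, since \<xi>1 \<le> \<xi> \<le> \<eta>1,
  so only values of \<open>v\<close> that are prescribed by \<open>V\<close> enter.\<close>

lemma goursat_equation_iff:
  assumes q: "L1_loc q" and V: "cont2 V"
    and v: "\<And>\<xi> \<eta>. 0 \<le> \<xi> \<Longrightarrow> \<xi> \<le> \<eta> \<Longrightarrow> v \<xi> \<eta> = V ((\<eta> - \<xi>) / 2) \<xi>"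
  shows "goursat_equation q v \<longleftrightarrow>
    (\<forall>x\<ge>0. \<forall>s\<ge>0. V x s = goursat_source q x s - goursat_operator q V x s)"
proof -
  have rhs: "- ((1/2) *\<^sub>R integral {\<xi>/2..\<eta>/2} q)
          - (1/4) *\<^sub>R integral {0..\<xi>} (\<lambda>\<xi>1. integral {\<xi>..\<eta>} (\<lambda>\<eta>1. q ((\<eta>1 - \<xi>1) / 2) ** v \<xi>1 \<eta>1))
     = goursat_source q ((\<eta> - \<xi>) / 2) \<xi> - goursat_operator q V ((\<eta> - \<xi>) / 2) \<xi>" if "0 \<le> \<xi>" "\<xi> \<le> \<eta>" for \<xi> \<eta>
  proof -
    have "integral {0..\<xi>} (\<lambda>\<xi>1. integral {\<xi>..\<eta>} (\<lambda>\<eta>1. q ((\<eta>1 - \<xi>1) / 2) ** v \<xi>1 \<eta>1))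
      = integral {0..\<xi>} (\<lambda>\<xi>1. integral {\<xi>..\<eta>} (\<lambda>\<eta>1. q ((\<eta>1 - \<xi>1) / 2) ** V ((\<eta>1 - \<xi>1) / 2) \<xi>1))"
      by (intro Henstock_Kurzweil_Integration.integral_cong) (simp add: v)
    also have "\<dots> = 4 *\<^sub>R goursat_operator q V ((\<eta> - \<xi>) / 2) \<xi>"
      by (rule goursat_double_integral[OF q V that])
    finally show ?thesis by (simp add: goursat_source_def field_simps)
  qed
  show ?thesis
  proof
    assume eq: "goursat_equation q v"
    show "\<forall>x\<ge>0. \<forall>s\<ge>0. V x s = goursat_source q x s - goursat_operator q V x s"
    proof (intro allI impI)
      fix x s :: real assume xs: "0 \<le> x" "0 \<le> s"
      have "v s (s + 2 * x) = goursat_source q ((s + 2 * x - s) / 2) s - goursat_operator q V ((s + 2 * x - s) / 2) s"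
        using eq xs rhs[of s "s + 2 * x"] by (simp add: goursat_equation_def)
      then show "V x s = goursat_source q x s - goursat_operator q V x s"
        using v[of s "s + 2 * x"] xs by simp
    qed
  next
    assume "\<forall>x\<ge>0. \<forall>s\<ge>0. V x s = goursat_source q x s - goursat_operator q V x s"
    then show "goursat_equation q v"
      unfolding goursat_equation_def by (simp add: rhs v)
  qed
qed

text \<open>Integrating the weight \<open>exp (L * z)\<close> up to at most \<open>s\<close> yields
  the gain \<open>1 / L\<close>. The bound on \<open>V\<close> is assumed only for points (y, z)
  with z + 2 y \<le> s + 2 x, the domain of dependence, so that the estimate can be iterated on a
  triangle.\<close>

lemma norm_strip_le:
  assumes V: "cont2 V" and xs: "0 \<le> x" "0 \<le> s" "0 \<le> y" and "L > 0" "C \<ge> 0"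
    and b: "\<And>z. 0 \<le> z \<Longrightarrow> z + 2 * y \<le> s + 2 * x \<Longrightarrow> norm (V y z) \<le> C * exp (L * z)"
  shows "norm (strip V x s y) \<le> C * exp (L * s) / L"
proof -
  let ?l = "max 0 (s - 2 * y)" and ?u = "min s (s + 2 * x - 2 * y)"
  show ?thesis
  proof (cases "?l \<le> ?u")
    case True
    have "((\<lambda>z. C * exp (L * z)) has_integral (C * exp (L * ?u) / L - C * exp (L * ?l) / L)) {?l..?u}"
      using True \<open>L > 0\<close>
      by (intro fundamental_theorem_of_calculus)
        (auto intro!: derivative_eq_intros simp: has_real_derivative_iff_has_vector_derivative[symmetric])
    from integral_unique[OF this]
    have e: "integral {?l..?u} (\<lambda>z. C * exp (L * z)) = C * exp (L * ?u) / L - C * exp (L * ?l) / L" .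
    have "norm (strip V x s y) = norm (integral {?l..?u} (V y))"
      using strip_eq_integral[OF V xs(1,3), of s] by (rule arg_cong)
    also have "\<dots> \<le> integral {?l..?u} (\<lambda>z. C * exp (L * z))"
      by (intro integral_norm_bound_integral integrable_continuous_interval continuous_on_cont2[OF V]
          continuous_intros b) auto
    also have "\<dots> = C * exp (L * ?u) / L - C * exp (L * ?l) / L" by (rule e)
    also have "\<dots> \<le> C * exp (L * ?u) / L" using assms by simp
    also have "\<dots> \<le> C * exp (L * s) / L" using assms by (intro divide_right_mono mult_left_mono) auto
    finally show ?thesis .
  next
    case False
    then have "strip V x s y = 0" using strip_eq_integral[OF V xs(1,3)] by simp
    then show ?thesis using assms by simp
  qed
qed

text \<open>In the norm weighted by \<open>exp (L * s)\<close> the operator is a contraction on each triangle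
  \<open>s + 2 * x \<le> S\<close>, provided that \<open>L\<close> exceeds the mass of \<open>q\<close>.\<close>

lemma goursat_operator_contraction:
  fixes q :: "real \<Rightarrow> complex^'n^'n"
  assumes q: "L1_loc q"
  obtains L where "L > 0"
    "\<And>V C x s. cont2 V \<Longrightarrow> C \<ge> 0 \<Longrightarrow> 0 \<le> x \<Longrightarrow> 0 \<le> s \<Longrightarrow> s + 2 * x \<le> S \<Longrightarrow>
      (\<And>y z. 0 \<le> y \<Longrightarrow> 0 \<le> z \<Longrightarrow> z + 2 * y \<le> S \<Longrightarrow> norm (V y z) \<le> C * exp (L * z)) \<Longrightarrow>
      norm (goursat_operator q V x s) \<le> C / 2 * exp (L * s)"
proof -
  interpret m: bounded_bilinear "(**) :: complex^'n^'n \<Rightarrow> complex^'n^'n \<Rightarrow> complex^'n^'n"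
    by (rule bounded_bilinear_matrix_matrix_mult)
  obtain K where K: "K \<ge> 0" "\<And>(x :: complex^'n^'n) (y :: complex^'n^'n). norm (x ** y) \<le> norm x * norm y * K"
    using m.nonneg_bounded by blast
  have qn: "(\<lambda>y. norm (q y)) integrable_on {0..T}" for T
    using L1_locD[OF q, of T] unfolding absolutely_integrable_on_def by (rule conjunct2)
  define N where "N = integral {0..S / 2} (\<lambda>y. norm (q y))"
  have "N \<ge> 0" unfolding N_def by (rule integral_nonneg[OF qn]) simp
  \<comment> \<open>\<open>N * K\<close> is the mass of \<open>q\<close> on the range y \<le> S / 2
    that the triangle can reach, times the constant of the matrix product; the summand 1 ensures
    positivity. The contraction factor 1/2 is then the one in front of the operator.\<close>
  define L where "L = N * K + 1"
  have "N * K \<ge> 0" using \<open>N \<ge> 0\<close> K(1) by simp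
  then have L: "L > 0" "N * K \<le> L" by (simp_all add: L_def)
  show thesis
  proof (rule that[OF L(1)])
    fix V :: "real \<Rightarrow> real \<Rightarrow> complex^'n^'n" and C x s :: real
    assume V: "cont2 V" and C: "C \<ge> 0" and xs: "0 \<le> x" "0 \<le> s" "s + 2 * x \<le> S"
      and b: "\<And>y z. 0 \<le> y \<Longrightarrow> 0 \<le> z \<Longrightarrow> z + 2 * y \<le> S \<Longrightarrow> norm (V y z) \<le> C * exp (L * z)"
    have "norm (integral {0..x + s / 2} (\<lambda>y. q y ** strip V x s y))
        \<le> integral {0..x + s / 2} (\<lambda>y. norm (q y)) * (C * exp (L * s) / L) * K"
    proof (rule norm_integral_product_le[where m = "strip V x s", OF bounded_bilinear_matrix_matrix_mult
          L1_locD[OF q] continuous_strip_section[OF V] K(2,1)])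
      fix y assume y: "y \<in> {0..x + s / 2}"
      show "norm (strip V x s y) \<le> C * exp (L * s) / L"
        by (rule norm_strip_le[OF V xs(1,2) _ L(1) C b]) (use y xs in auto)
    qed
    also have "\<dots> \<le> N * (C * exp (L * s) / L) * K"
    proof (intro mult_right_mono K(1))
      show "integral {0..x + s / 2} (\<lambda>y. norm (q y)) \<le> N"
        unfolding N_def by (rule integral_subset_le[OF _ qn qn]) (use xs in auto)
      show "0 \<le> C * exp (L * s) / L" using C L by simp
    qed
    also have "\<dots> = N * K / L * (C * exp (L * s))" by simp
    also have "\<dots> \<le> 1 * (C * exp (L * s))"
      using L C by (intro mult_right_mono) auto
    finally show "norm (goursat_operator q V x s) \<le> C / 2 * exp (L * s)"
      by (simp add: goursat_operator_def)
  qed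
qed

section \<open>Unique solvability of the Goursat equation\<close>

lemma cont2_clamp:
  assumes V: "\<And>R. continuous_on (ball 0 R) (\<lambda>p :: real \<times> real. V (max 0 (fst p)) (max 0 (snd p)))"
  shows "cont2 (\<lambda>x s. V (max 0 x) (max 0 s))"
  using continuous_on_UNIV_balls[OF V] by (simp add: split_beta')

lemma ball_coordinates:
  assumes "p \<in> ball (0 :: real \<times> real) R"
  shows "\<bar>fst p\<bar> < R" "\<bar>snd p\<bar> < R"
  using assms dist_fst_le[of 0 p] dist_snd_le[of 0 p] by auto

lemma cont2_goursat_source:
  assumes q: "L1_loc q"
  shows "cont2 (\<lambda>x s. goursat_source q (max 0 x) (max 0 s))"
proof (rule cont2_clamp)
  fix R
  define J where "J = (\<lambda>t. integral {0..t} q)"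
  have J: "continuous_on {0..2 * R} J"
    unfolding J_def by (rule indefinite_integral_continuous_1[OF L1_loc_integrable[OF q]]) simp
  have eq: "goursat_source q x s = - ((1/2) *\<^sub>R (J (s / 2 + x) - J (s / 2)))" if "0 \<le> x" "0 \<le> s" for x s
  proof -
    have "J (s / 2) + integral {s / 2..s / 2 + x} q = J (s / 2 + x)"
      unfolding J_def using that
      by (intro Henstock_Kurzweil_Integration.integral_combine L1_loc_integrable[OF q]) auto
    then have "integral {s / 2..s / 2 + x} q = J (s / 2 + x) - J (s / 2)" by (simp add: algebra_simps)
    then show ?thesis by (simp add: goursat_source_def)
  qed
  have "continuous_on (ball 0 R) (\<lambda>p :: real \<times> real. - ((1/2) *\<^sub>R
      (J (max 0 (snd p) / 2 + max 0 (fst p)) - J (max 0 (snd p) / 2))))"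
  proof (intro continuous_intros continuous_on_compose2[OF J] image_subsetI)
    fix p :: "real \<times> real" assume "p \<in> ball 0 R"
    then have "\<bar>fst p\<bar> < R" "\<bar>snd p\<bar> < R" by (rule ball_coordinates)+
    then show "max 0 (snd p) / 2 + max 0 (fst p) \<in> {0..2 * R}" "max 0 (snd p) / 2 \<in> {0..2 * R}"
      by auto
  qed auto
  then show "continuous_on (ball 0 R) (\<lambda>p :: real \<times> real. goursat_source q (max 0 (fst p)) (max 0 (snd p)))"
    by (simp add: eq)
qed

lemma cont2_goursat_operator:
  fixes q :: "real \<Rightarrow> complex^'n^'n"
  assumes q: "L1_loc q" and V: "cont2 V"
  shows "cont2 (\<lambda>x s. goursat_operator q V (max 0 x) (max 0 s))"
proof (rule cont2_clamp)
  fix R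
  \<comment> \<open>On the ball both coordinates are below \<open>R\<close> in absolute value, so x
    + s / 2 stays below \<open>2 * R\<close> and this limit serves for all parameters at
    once.\<close>
  define G where "G = (\<lambda>p :: real \<times> real. (1/2) *\<^sub>R integral {0..2 * R} (\<lambda>y. q y ** strip V (fst p) (snd p) y))"
  have "continuous_on UNIV G"
    unfolding G_def
    by (intro continuous_intros continuous_on_integral_product[where m = "\<lambda>y p. strip V (fst p) (snd p) y"]
        bounded_bilinear_matrix_matrix_mult L1_locD[OF q] continuous_strip[OF V])
  then have "continuous_on (ball 0 R) (\<lambda>p :: real \<times> real. G (max 0 (fst p), max 0 (snd p)))"
    by (rule continuous_on_compose2) (auto intro!: continuous_intros)
  then show "continuous_on (ball 0 R) (\<lambda>p :: real \<times> real. goursat_operator q V (max 0 (fst p)) (max 0 (snd p)))"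
  proof (rule continuous_on_eq)
    fix p :: "real \<times> real" assume "p \<in> ball 0 R"
    then have "\<bar>fst p\<bar> < R" "\<bar>snd p\<bar> < R" by (rule ball_coordinates)+
    then have "goursat_operator q V (max 0 (fst p)) (max 0 (snd p))
        = (1/2) *\<^sub>R integral {0..2 * R} (\<lambda>y. q y ** strip V (max 0 (fst p)) (max 0 (snd p)) y)"
      by (intro goursat_operator_eq[OF q V]) auto
    then show "G (max 0 (fst p), max 0 (snd p)) = goursat_operator q V (max 0 (fst p)) (max 0 (snd p))"
      by (simp add: G_def)
  qed
qed

text \<open>The difference \<open>D\<close> of two solutions satisfies the homogeneous equation.
  Iterating the contraction on the triangle through (x, s), starting from any bound of
  \<open>D\<close> there, shows \<open>D\<close> to be smaller than every term of a geometric
  sequence tending to zero.\<close>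

lemma goursat_unique:
  fixes q :: "real \<Rightarrow> complex^'n^'n"
  assumes q: "L1_loc q" and V: "cont2 V" and W: "cont2 W"
    and eqV: "\<forall>x\<ge>0. \<forall>s\<ge>0. V x s = goursat_source q x s - goursat_operator q V x s"
    and eqW: "\<forall>x\<ge>0. \<forall>s\<ge>0. W x s = goursat_source q x s - goursat_operator q W x s"
    and xs: "0 \<le> x" "0 \<le> s"
  shows "V x s = W x s"
proof -
  define S where "S = s + 2 * x"
  obtain L where L: "L > 0"
    "\<And>V C x s. cont2 V \<Longrightarrow> C \<ge> 0 \<Longrightarrow> 0 \<le> x \<Longrightarrow> 0 \<le> s \<Longrightarrow> s + 2 * x \<le> S \<Longrightarrow>
      (\<And>y z. 0 \<le> y \<Longrightarrow> 0 \<le> z \<Longrightarrow> z + 2 * y \<le> S \<Longrightarrow> norm (V y z) \<le> C * exp (L * z)) \<Longrightarrow>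
      norm (goursat_operator q V x s) \<le> C / 2 * exp (L * s)"
    using goursat_operator_contraction[OF q] by blast
  define D where "D = (\<lambda>x s. V x s - W x s)"
  have D: "cont2 D"
    using continuous_on_diff[OF V W] by (simp add: D_def split_beta')
  have Deq: "D x s = - goursat_operator q D x s" if "0 \<le> x" "0 \<le> s" for x s
  proof -
    have "D x s = - (goursat_operator q V x s - goursat_operator q W x s)"
      using eqV that eqW by (simp add: D_def)
    then show ?thesis unfolding goursat_operator_diff[OF q V W] by (simp add: D_def)
  qed
  obtain B where B: "\<And>y z. y \<in> {0..S} \<Longrightarrow> z \<in> {0..S} \<Longrightarrow> norm (D y z) \<le> B"
    using bounded_cont2[OF D] by metis
  have "norm (D y z) \<le> \<bar>B\<bar> * (1/2) ^ n * exp (L * z)" if "0 \<le> y" "0 \<le> z" "z + 2 * y \<le> S" for n y z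
    using that
  proof (induction n arbitrary: y z)
    case 0
    then have "norm (D y z) \<le> \<bar>B\<bar>" using B[of y z] by auto
    also have "\<dots> \<le> \<bar>B\<bar> * exp (L * z)" using 0 L by (simp add: mult_le_cancel_left1)
    finally show ?case by simp
  next
    case (Suc n)
    then have "norm (D y z) = norm (goursat_operator q D y z)" by (simp add: Deq)
    also have "\<dots> \<le> (\<bar>B\<bar> * (1/2) ^ n) / 2 * exp (L * z)"
      by (rule L(2)[OF D]) (use Suc in auto)
    finally show ?case by simp
  qed
  from this[of x s] have le: "norm (D x s) \<le> \<bar>B\<bar> * (1/2) ^ n * exp (L * s)" for n
    using xs by (simp add: S_def)
  have lim: "(\<lambda>n. \<bar>B\<bar> * (1/2) ^ n * exp (L * s)) \<longlonglongrightarrow> \<bar>B\<bar> * 0 * exp (L * s)"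
    by (intro tendsto_intros LIMSEQ_realpow_zero) auto
  have "norm (D x s) \<le> \<bar>B\<bar> * 0 * exp (L * s)"
    by (rule LIMSEQ_le_const[OF lim]) (use le in blast)
  then show ?thesis by (simp add: D_def)
qed

text \<open>Picard iteration from zero. Successive differences are mapped into each other by the
  negative operator, hence decay like (1/2)^n on every triangle, and the Weierstrass test gives
  convergence uniform on balls. \<open>L\<close> depends on the triangle, but the iterates and their
  limit do not.\<close>

lemma goursat_exists:
  fixes q :: "real \<Rightarrow> complex^'n^'n"
  assumes q: "L1_loc q"
  shows "\<exists>V. cont2 V \<and> (\<forall>x\<ge>0. \<forall>s\<ge>0. V x s = goursat_source q x s - goursat_operator q V x s)"
proof -
  define g where "g = (\<lambda>x s. goursat_source q (max 0 x) (max 0 s))"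
  define K where "K = (\<lambda>V x s. goursat_operator q V (max 0 x) (max 0 s))"
  define P where "P = rec_nat (\<lambda>x s. 0 :: complex^'n^'n) (\<lambda>n V x s. g x s - K V x s)"
  have P0: "P 0 = (\<lambda>x s. 0)" and PS: "P (Suc n) = (\<lambda>x s. g x s - K (P n) x s)" for n
    by (simp_all add: P_def)
  have g: "cont2 g" unfolding g_def by (rule cont2_goursat_source[OF q])
  have K: "cont2 (K V)" if "cont2 V" for V unfolding K_def by (rule cont2_goursat_operator[OF q that])
  have P: "cont2 (P n)" for n
  proof (induction n)
    case (Suc n)
    then show ?case using continuous_on_diff[OF g K[OF Suc]] by (simp add: PS split_beta')
  qed (simp add: P0)
  define d where "d = (\<lambda>n x s. P (Suc n) x s - P n x s)"
  have d: "cont2 (d n)" for n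
    using continuous_on_diff[OF P[of "Suc n"] P[of n]] by (simp add: d_def split_beta')
  \<comment> \<open>The contraction estimate is available on the quadrant only; this identity
    carries it to the entire ball.\<close>
  have d_clamp: "d n x s = d n (max 0 x) (max 0 s)" for n x s
    by (cases n) (simp_all add: d_def PS P0 g_def K_def)
  have d_Suc: "d (Suc n) x s = - K (d n) x s" for n x s
  proof -
    have "d (Suc n) x s = - (goursat_operator q (P (Suc n)) (max 0 x) (max 0 s)
        - goursat_operator q (P n) (max 0 x) (max 0 s))"
      by (simp add: d_def PS[of "Suc n"] PS[of n] K_def)
    then show ?thesis unfolding goursat_operator_diff[OF q P P] by (simp add: K_def d_def)
  qed
  have sum_d: "(\<Sum>i<n. d i x s) = P n x s" for n x s
    unfolding d_def by (subst sum_lessThan_telescope) (simp add: P0)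
  define V where "V = (\<lambda>x s. \<Sum>n. d n x s)"
  have unif: "uniform_limit (ball 0 R) (\<lambda>n (x, s). P n x s) (\<lambda>(x, s). V x s) sequentially" for R
  proof -
    \<comment> \<open>In the ball of radius \<open>R\<close> both coordinates are below
      \<open>R\<close>, so z + 2 y < 3 R after clamping.\<close>
    define S where "S = 3 * R"
    obtain L where L: "L > 0"
      "\<And>V C x s. cont2 V \<Longrightarrow> C \<ge> 0 \<Longrightarrow> 0 \<le> x \<Longrightarrow> 0 \<le> s \<Longrightarrow> s + 2 * x \<le> S \<Longrightarrow>
      (\<And>y z. 0 \<le> y \<Longrightarrow> 0 \<le> z \<Longrightarrow> z + 2 * y \<le> S \<Longrightarrow> norm (V y z) \<le> C * exp (L * z)) \<Longrightarrow>
      norm (goursat_operator q V x s) \<le> C / 2 * exp (L * s)"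
      using goursat_operator_contraction[OF q, of S] by blast
    obtain B where B: "\<And>y z. y \<in> {0..S} \<Longrightarrow> z \<in> {0..S} \<Longrightarrow> norm (d 0 y z) \<le> B"
      using bounded_cont2[OF d] by metis
    have bound: "norm (d n y z) \<le> \<bar>B\<bar> * (1/2) ^ n * exp (L * z)" if "0 \<le> y" "0 \<le> z" "z + 2 * y \<le> S" for n y z
      using that
    proof (induction n arbitrary: y z)
      case 0
      then have "norm (d 0 y z) \<le> \<bar>B\<bar>" using B[of y z] by auto
      also have "\<dots> \<le> \<bar>B\<bar> * exp (L * z)" using 0 L by (simp add: mult_le_cancel_left1)
      finally show ?case by simp
    next
      case (Suc n)
      then have "norm (d (Suc n) y z) = norm (goursat_operator q (d n) y z)" by (simp add: d_Suc K_def)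
      also have "\<dots> \<le> (\<bar>B\<bar> * (1/2) ^ n) / 2 * exp (L * z)"
        by (rule L(2)[OF d]) (use Suc in auto)
      finally show ?case by simp
    qed
    have "uniform_limit (ball 0 R) (\<lambda>n p. \<Sum>i<n. d i (fst p) (snd p)) (\<lambda>p. \<Sum>i. d i (fst p) (snd p)) sequentially"
    proof (rule Weierstrass_m_test)
      show "summable (\<lambda>n. \<bar>B\<bar> * exp (L * S) * (1/2) ^ n)" by (intro summable_mult summable_geometric) simp
      fix n :: nat and p :: "real \<times> real" assume p: "p \<in> ball 0 R"
      let ?y = "max 0 (fst p)" and ?z = "max 0 (snd p)"
      have yz: "?z + 2 * ?y \<le> S" using ball_coordinates[OF p] by (auto simp: S_def)
      have "norm (d n (fst p) (snd p)) \<le> \<bar>B\<bar> * (1/2) ^ n * exp (L * ?z)"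
        by (subst d_clamp, rule bound) (use yz in auto)
      also have "\<dots> \<le> \<bar>B\<bar> * (1/2) ^ n * exp (L * S)"
        using yz L by (intro mult_left_mono) auto
      finally show "norm (d n (fst p) (snd p)) \<le> \<bar>B\<bar> * exp (L * S) * (1/2) ^ n"
        by (simp add: mult_ac)
    qed
    then show ?thesis by (simp add: sum_d V_def split_beta')
  qed
  have V: "cont2 V"
  proof (rule continuous_on_UNIV_balls)
    show "continuous_on (ball 0 R) (\<lambda>(y, z). V y z)" for R
      by (rule uniform_limit_theorem[OF _ unif]) (auto intro!: always_eventually continuous_on_subset[OF P])
  qed
  have "V x s = goursat_source q x s - goursat_operator q V x s" if xs: "0 \<le> x" "0 \<le> s" for x s
  proof -
    define S where "S = s + 2 * x"
    obtain L where L: "L > 0"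
      "\<And>V C x s. cont2 V \<Longrightarrow> C \<ge> 0 \<Longrightarrow> 0 \<le> x \<Longrightarrow> 0 \<le> s \<Longrightarrow> s + 2 * x \<le> S \<Longrightarrow>
      (\<And>y z. 0 \<le> y \<Longrightarrow> 0 \<le> z \<Longrightarrow> z + 2 * y \<le> S \<Longrightarrow> norm (V y z) \<le> C * exp (L * z)) \<Longrightarrow>
      norm (goursat_operator q V x s) \<le> C / 2 * exp (L * s)"
      using goursat_operator_contraction[OF q, of S] by blast
    have in_ball: "(y, z) \<in> ball 0 (2 * S + 1)" if "0 \<le> y" "0 \<le> z" "z + 2 * y \<le> S" for y z
      using norm_Pair_le[of y z] that unfolding mem_ball_0 by simp
    have lim: "(\<lambda>n. P n x s) \<longlonglongrightarrow> V x s"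
      using tendsto_uniform_limitI[OF unif in_ball[of x s]] xs by (simp add: S_def)
    have "(\<lambda>n. goursat_operator q (P n) x s) \<longlonglongrightarrow> goursat_operator q V x s"
    proof (rule metric_LIMSEQ_I)
      fix r :: real assume "r > 0"
      \<comment> \<open>The limit passes through the operator by the contraction estimate itself,
        applied to \<open>P n - V\<close> with \<open>C = e\<close>. This bounds the error by
        \<open>e / 2 * exp (L * s)\<close>, which is \<open>r / 2\<close>.\<close>
      define e where "e = r / exp (L * s)"
      have "e > 0" using \<open>r > 0\<close> by (simp add: e_def)
      from uniform_limitD[OF unif this, of "2 * S + 1"]
      obtain N where N: "\<forall>n\<ge>N. \<forall>p\<in>ball 0 (2 * S + 1). dist (case p of (x, s) \<Rightarrow> P n x s) (case p of (x, s) \<Rightarrow> V x s) < e"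
        unfolding eventually_sequentially by blast
      have "dist (goursat_operator q (P n) x s) (goursat_operator q V x s) < r" if "n \<ge> N" for n
      proof -
        have PV: "cont2 (\<lambda>y z. P n y z - V y z)"
          using continuous_on_diff[OF P[of n] V] by (simp add: split_beta')
        have "norm (goursat_operator q (\<lambda>y z. P n y z - V y z) x s) \<le> e / 2 * exp (L * s)"
        proof (rule L(2)[OF PV])
          fix y z :: real assume yz: "0 \<le> y" "0 \<le> z" "z + 2 * y \<le> S"
          have "norm (P n y z - V y z) \<le> e * 1"
            using N[rule_format, OF that in_ball[OF yz]] by (simp add: dist_norm)
          also have "\<dots> \<le> e * exp (L * z)" using \<open>e > 0\<close> L yz by (intro mult_left_mono) auto
          finally show "norm (P n y z - V y z) \<le> e * exp (L * z)" .
        qed (use xs \<open>e > 0\<close> in \<open>auto simp: S_def\<close>)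
        also have "\<dots> = r / 2" by (simp add: e_def)
        also have "\<dots> < r" using \<open>r > 0\<close> by simp
        finally show ?thesis by (simp add: dist_norm goursat_operator_diff[OF q P V])
      qed
      then show "\<exists>no. \<forall>n\<ge>no. dist (goursat_operator q (P n) x s) (goursat_operator q V x s) < r" by blast
    qed
    then have "(\<lambda>n. P (Suc n) x s) \<longlonglongrightarrow> goursat_source q x s - goursat_operator q V x s"
      using xs by (simp add: PS g_def K_def tendsto_diff)
    with LIMSEQ_Suc[OF lim] show ?thesis by (rule LIMSEQ_unique)
  qed
  with V show ?thesis by blast
qed

text \<open>The kernel is given by a definite description, so existence and uniqueness of the
  normalised solution must be known before anything can be said about it. \<open>chg\<close>
  rewrites a solution in the coordinates (x, s) and clamps it, and thereby transfers both facts from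
  \<open>V\<close>; outside the region the normalisation decides.\<close>

theorem kernel_w_characteristic_coordinates:
  fixes q :: "real \<Rightarrow> complex^'n^'n"
  assumes q: "L1_loc q"
  shows "\<exists>V. cont2 V \<and> (\<forall>x\<ge>0. \<forall>s\<ge>0. kernel_w q x (x + s) = V x s) \<and>
    (\<forall>x\<ge>0. \<forall>s\<ge>0. V x s = goursat_source q x s - goursat_operator q V x s)"
proof -
  define sol where "sol = (\<lambda>v. continuous_on goursat_region (\<lambda>(\<xi>, \<eta>). v \<xi> \<eta>) \<and>
             goursat_equation q v \<and>
             (\<forall>\<xi> \<eta>. (\<xi>, \<eta>) \<notin> goursat_region \<longrightarrow> v \<xi> \<eta> = 0))"
  define chg where "chg = (\<lambda>(v :: real \<Rightarrow> real \<Rightarrow> complex^'n^'n) x s. v (max 0 s) (max 0 s + 2 * max 0 x))"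
  have chg: "cont2 (chg v) \<and> (\<forall>x\<ge>0. \<forall>s\<ge>0. chg v x s = goursat_source q x s - goursat_operator q (chg v) x s)"
    if v: "sol v" for v
  proof
    have vc: "continuous_on goursat_region (\<lambda>(\<xi>, \<eta>). v \<xi> \<eta>)" using v by (simp add: sol_def)
    have "continuous_on UNIV (\<lambda>p :: real \<times> real. (max 0 (snd p), max 0 (snd p) + 2 * max 0 (fst p)))"
      by (intro continuous_intros)
    from continuous_on_compose2[OF vc this]
    show c: "cont2 (chg v)" by (simp add: chg_def split_beta' goursat_region_def image_subset_iff)
    show "\<forall>x\<ge>0. \<forall>s\<ge>0. chg v x s = goursat_source q x s - goursat_operator q (chg v) x s"
    proof (rule iffD1[OF goursat_equation_iff[OF q c]])
      show "goursat_equation q v" using v by (simp add: sol_def)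
      show "v \<xi> \<eta> = chg v ((\<eta> - \<xi>) / 2) \<xi>" if "0 \<le> \<xi>" "\<xi> \<le> \<eta>" for \<xi> \<eta>
        using that by (simp add: chg_def diff_divide_distrib)
    qed
  qed
  obtain V0 where V0: "cont2 V0" "\<forall>x\<ge>0. \<forall>s\<ge>0. V0 x s = goursat_source q x s - goursat_operator q V0 x s"
    using goursat_exists[OF q] by blast
  have "\<exists>!v. sol v"
  proof (rule ex_ex1I)
    define v where "v = (\<lambda>\<xi> \<eta>. if 0 \<le> \<xi> \<and> \<xi> \<le> \<eta> then V0 ((\<eta> - \<xi>) / 2) \<xi> else 0)"
    have "continuous_on goursat_region (\<lambda>p. V0 ((snd p - fst p) / 2) (fst p))"
      by (intro continuous_on_cont2[OF V0(1)] continuous_intros) simp_all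
    then have "continuous_on goursat_region (\<lambda>(\<xi>, \<eta>). v \<xi> \<eta>)"
      by (rule continuous_on_eq) (auto simp: v_def goursat_region_def)
    moreover have "goursat_equation q v"
      by (rule iffD2[OF goursat_equation_iff[OF q V0(1)] V0(2)]) (simp add: v_def)
    moreover have "v \<xi> \<eta> = 0" if "(\<xi>, \<eta>) \<notin> goursat_region" for \<xi> \<eta>
      unfolding v_def using that by (intro if_not_P) (simp add: goursat_region_def)
    ultimately have "sol v" unfolding sol_def by blast
    then show "\<exists>v. sol v" by blast
  next
    fix v v' assume sol: "sol v" "sol v'"
    have "v \<xi> \<eta> = v' \<xi> \<eta>" for \<xi> \<eta>
    proof (cases "(\<xi>, \<eta>) \<in> goursat_region")
      case True
      then have "0 \<le> \<xi>" "\<xi> \<le> \<eta>" by (auto simp: goursat_region_def)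
      moreover from this have "chg v ((\<eta> - \<xi>) / 2) \<xi> = chg v' ((\<eta> - \<xi>) / 2) \<xi>"
        by (intro goursat_unique[OF q conjunct1[OF chg[OF sol(1)]] conjunct1[OF chg[OF sol(2)]]
              conjunct2[OF chg[OF sol(1)]] conjunct2[OF chg[OF sol(2)]]]) simp_all
      ultimately show ?thesis by (simp add: chg_def diff_divide_distrib)
    next
      case False
      then show ?thesis using sol by (simp add: sol_def)
    qed
    then show "v = v'" by blast
  qed
  then have sol: "sol (goursat_solution q)"
    unfolding goursat_solution_def sol_def by (rule theI')
  have "kernel_w q x (x + s) = chg (goursat_solution q) x s" if "0 \<le> x" "0 \<le> s" for x s
    using that by (simp add: kernel_w_def chg_def algebra_simps)
  with chg[OF sol] show ?thesis by blast
qed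

section \<open>Convolution with causal functions\<close>

text \<open>Vanishing at 0 as well as for negative arguments, together with continuity on the whole
  line, makes antiderivatives and convolutions join continuously to zero, and lets integrals in time
  start at any nonpositive point.\<close>

definition causal :: "(real \<Rightarrow> 'a::real_normed_vector) \<Rightarrow> bool" where
  "causal F \<longleftrightarrow> continuous_on UNIV F \<and> (\<forall>s\<le>0. F s = 0)"

definition antiderivative :: "(real \<Rightarrow> 'a::euclidean_space) \<Rightarrow> real \<Rightarrow> 'a" where
  "antiderivative F s = integral {0..s} F"

lemma antiderivative_nonpos: "s \<le> 0 \<Longrightarrow> antiderivative F s = 0"
  by (cases "s = 0") (auto simp: antiderivative_def)

lemma antiderivative_has_vector_derivative:
  assumes F: "causal F"
  shows "(antiderivative F has_vector_derivative F s) (at s)"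
proof -
  \<comment> \<open>A base point to the left of both 0 and \<open>s\<close> makes \<open>s\<close>
    an interior point, so that the fundamental theorem gives a two-sided derivative for
    \<open>s \<le> 0\<close> too. The integral from \<open>a\<close> to 0 vanishes by
    causality.\<close>
  define a where "a = - \<bar>s\<bar> - 1"
  have c: "continuous_on S F" for S using F continuous_on_subset by (auto simp: causal_def)
  have eq: "integral {a..u} F = antiderivative F u" if "a < u" for u
  proof (cases "0 \<le> u")
    case True
    have "integral {a..0} F + integral {0..u} F = integral {a..u} F"
      using True by (intro Henstock_Kurzweil_Integration.integral_combine integrable_continuous_interval c)
        (auto simp: a_def)
    moreover have "integral {a..0} F = integral {a..0} (\<lambda>_. 0)"
      using F by (intro Henstock_Kurzweil_Integration.integral_cong) (auto simp: causal_def)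
    ultimately show ?thesis by (simp add: antiderivative_def)
  next
    case False
    have "integral {a..u} F = integral {a..u} (\<lambda>_. 0)"
      using F False by (intro Henstock_Kurzweil_Integration.integral_cong) (auto simp: causal_def)
    then show ?thesis using False by (simp add: antiderivative_nonpos)
  qed
  have "((\<lambda>u. integral {a..u} F) has_vector_derivative F s) (at s within {a..s + 1})"
    by (rule integral_has_vector_derivative[OF c]) (auto simp: a_def)
  then have "((\<lambda>u. integral {a..u} F) has_vector_derivative F s) (at s)"
    by (simp add: at_within_Icc_at a_def)
  then show ?thesis
    by (rule has_vector_derivative_transform_within_open[of _ _ _ "{a<..}"])
      (auto simp: a_def[symmetric] eq, simp add: a_def)
qed

lemma has_vector_derivative_chain_real:
  assumes "(f has_vector_derivative f') (at (u z))" "(u has_real_derivative c) (at z)"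
  shows "((\<lambda>z. f (u z)) has_vector_derivative c *\<^sub>R f') (at z)"
  using vector_diff_chain_at[of u c z f f'] assms
  by (simp add: o_def has_real_derivative_iff_has_vector_derivative)

lemma antiderivative_chain:
  assumes F: "causal F" and u: "(u has_real_derivative c) (at z)"
  shows "((\<lambda>z. antiderivative F (u z)) has_vector_derivative c *\<^sub>R F (u z)) (at z)"
  by (rule has_vector_derivative_chain_real[OF antiderivative_has_vector_derivative[OF F] u])

lemma causal_antiderivative: "causal F \<Longrightarrow> causal (antiderivative F)"
  unfolding causal_def[of "antiderivative F"]
  by (auto simp: antiderivative_nonpos
      intro!: continuous_at_imp_continuous_on has_vector_derivative_continuous antiderivative_has_vector_derivative)

definition causal_convolution ::
  "(real \<Rightarrow> real \<Rightarrow> complex^'n^'n) \<Rightarrow> (real \<Rightarrow> complex^'n) \<Rightarrow> real \<Rightarrow> real \<Rightarrow> complex^'n" where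
  "causal_convolution V F x s = integral {0..s} (\<lambda>z. V x z *v F (s - z))"

lemma causal_convolution_nonpos: "s \<le> 0 \<Longrightarrow> causal_convolution V F x s = 0"
  by (cases "s = 0") (auto simp: causal_convolution_def)

lemma continuous_on_matrix_vector [continuous_intros]:
  fixes A :: "'p::topological_space \<Rightarrow> complex^'n^'m"
  shows "continuous_on S A \<Longrightarrow> continuous_on S b \<Longrightarrow> continuous_on S (\<lambda>p. A p *v b p)"
  by (rule bounded_bilinear.continuous_on[OF bounded_bilinear_matrix_vector_mult])

lemma continuous_on_causal:
  assumes "causal F" "continuous_on S g"
  shows "continuous_on S (\<lambda>p. F (g p))"
  using assms continuous_on_compose2[of UNIV F S g] by (auto simp: causal_def)

lemma cont2_causal_convolution:
  assumes V: "cont2 V" and F: "causal F"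
  shows "cont2 (causal_convolution V F)"
proof -
  have "continuous_on UNIV (\<lambda>p. integral {0..snd p} (\<lambda>z. V (fst p) z *v F (snd p - z)))"
    by (rule continuous_on_integral_upto)
      (auto simp: split_beta intro!: continuous_intros continuous_on_cont2[OF V] continuous_on_causal[OF F])
  then show ?thesis by (simp add: causal_convolution_def split_beta')
qed

lemma causal_section:
  assumes "cont2 V" "causal F"
  shows "causal (causal_convolution V F x)"
  unfolding causal_def
  using continuous_on_cont2[OF cont2_causal_convolution[OF assms], of UNIV "\<lambda>_. x" "\<lambda>s. s"]
  by (simp add: causal_convolution_nonpos)

text \<open>Since \<open>F (r - z)\<close> is zero for \<open>r < z\<close>, the antiderivative at
  \<open>s - z\<close> is an integral of \<open>F (r - z)\<close> over the fixed interval from 0 to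
  \<open>s\<close>. Fubini's theorem then interchanges convolution and integration in time. This is
  why differentiating a response in time only changes the control.\<close>

lemma causal_convolution_antiderivative:
  assumes V: "cont2 V" and F: "causal F"
  shows "causal_convolution V (antiderivative F) x = antiderivative (causal_convolution V F x)"
proof
  fix s
  have qx: "V x absolutely_integrable_on {0..s}"
    by (intro absolutely_integrable_continuous_real) (rule continuous_on_cont2[OF V]; intro continuous_intros)
  have m: "(\<lambda>(z, r). F (r - z)) \<in> borel_measurable borel"
    unfolding split_beta' by (intro borel_measurable_continuous_onI continuous_on_causal[OF F] continuous_intros)
  have "cont2 (\<lambda>z r. F (r - z))"
    unfolding split_beta' by (intro continuous_on_causal[OF F] continuous_intros)
  then obtain B where B: "\<And>z r. z \<in> {0..s} \<Longrightarrow> r \<in> {0..s} \<Longrightarrow> norm (F (r - z)) \<le> B"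
    using bounded_cont2 by metis
  have inner: "antiderivative F (s - z) = integral {0..s} (\<lambda>r. F (r - z))" if "z \<in> {0..s}" for z
  proof -
    have "((\<lambda>r. F (r - z)) has_integral (antiderivative F (s - z) - antiderivative F (0 - z))) {0..s}"
    proof (rule fundamental_theorem_of_calculus)
      fix r
      show "((\<lambda>r. antiderivative F (r - z)) has_vector_derivative F (r - z)) (at r within {0..s})"
      proof (rule has_vector_derivative_at_within)
        have "((\<lambda>r. r - z) has_real_derivative 1) (at r)" by (auto intro!: derivative_eq_intros)
        from antiderivative_chain[OF F this]
        show "((\<lambda>r. antiderivative F (r - z)) has_vector_derivative F (r - z)) (at r)" by simp
      qed
    qed (use that in auto)
    then show ?thesis using that by (simp add: integral_unique antiderivative_nonpos)
  qed
  have outer: "integral {0..s} (\<lambda>z. V x z *v F (r - z)) = causal_convolution V F x r" if "r \<in> {0..s}" for r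
  proof -
    have int: "(\<lambda>z. V x z *v F (r - z)) integrable_on {0..s}"
      by (intro integrable_continuous_interval continuous_intros continuous_on_cont2[OF V] continuous_on_causal[OF F])
    have "integral {0..r} (\<lambda>z. V x z *v F (r - z)) + integral {r..s} (\<lambda>z. V x z *v F (r - z))
        = integral {0..s} (\<lambda>z. V x z *v F (r - z))"
      using that by (intro Henstock_Kurzweil_Integration.integral_combine int) auto
    moreover have "integral {r..s} (\<lambda>z. V x z *v F (r - z)) = integral {r..s} (\<lambda>z. 0)"
      using F by (intro Henstock_Kurzweil_Integration.integral_cong) (simp add: causal_def)
    ultimately show ?thesis by (simp add: causal_convolution_def)
  qed
  have "causal_convolution V (antiderivative F) x s = integral {0..s} (\<lambda>z. V x z *v integral {0..s} (\<lambda>r. F (r - z)))"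
    unfolding causal_convolution_def
    by (intro Henstock_Kurzweil_Integration.integral_cong) (simp add: inner)
  also have "\<dots> = integral {0..s} (\<lambda>r. integral {0..s} (\<lambda>z. V x z *v F (r - z)))"
    by (rule fubini_weighted(2)[OF bounded_bilinear_matrix_vector_mult qx m B, symmetric])
  also have "\<dots> = integral {0..s} (causal_convolution V F x)"
    by (intro Henstock_Kurzweil_Integration.integral_cong outer)
  finally show "causal_convolution V (antiderivative F) x s = antiderivative (causal_convolution V F x) s"
    by (simp add: antiderivative_def)
qed

text \<open>Integration by parts moves the antiderivative from the kernel to \<open>F\<close>. Both
  boundary terms vanish: the primitive is zero at \<open>z = 0\<close> and the antiderivative of
  \<open>F\<close> is zero at \<open>s - s\<close>.\<close>

lemma causal_convolution_primitive:
  assumes V: "cont2 V" and F: "causal F"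
  shows "causal_convolution (primitive V) F x s = causal_convolution V (antiderivative F) x s"
proof (cases "0 \<le> s")
  case True
  have cV: "continuous_on S (V x)" for S
    using continuous_on_cont2[OF V, of S "\<lambda>_. x" "\<lambda>z. z"] by (simp add: continuous_intros)
  have pV: "continuous_on S (primitive V x)" for S
    using continuous_on_cont2[OF cont2_primitive[OF V], of S "\<lambda>_. x" "\<lambda>z. z"] by (simp add: continuous_intros)
  have "((\<lambda>z. V x z *v antiderivative F (s - z)) has_integral causal_convolution (primitive V) F x s) {0..s}"
  proof (rule integration_by_parts_interior[OF bounded_bilinear_matrix_vector_mult True])
    show "continuous_on {0..s} (primitive V x)" by (rule pV)
    show "continuous_on {0..s} (\<lambda>z. antiderivative F (s - z))"
      by (intro continuous_on_causal[OF causal_antiderivative[OF F]] continuous_intros)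
    fix z assume z: "z \<in> {0<..<s}"
    have "((\<lambda>u. integral {0..u} (V x)) has_vector_derivative V x z) (at z within {0..s})"
      by (rule integral_has_vector_derivative[OF cV]) (use z in auto)
    then show "(primitive V x has_vector_derivative V x z) (at z)"
      using z by (simp add: at_within_Icc_at primitive_def[abs_def])
    show "((\<lambda>z. antiderivative F (s - z)) has_vector_derivative - F (s - z)) (at z)"
    proof -
      have "((\<lambda>z. s - z) has_real_derivative - 1) (at z)" by (auto intro!: derivative_eq_intros)
      from antiderivative_chain[OF F this] show ?thesis by simp
    qed
  next
    have "((\<lambda>z. primitive V x z *v F (s - z)) has_integral causal_convolution (primitive V) F x s) {0..s}"
      unfolding causal_convolution_def
      by (intro integrable_integral integrable_continuous_interval continuous_intros pV continuous_on_causal[OF F])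
    from has_integral_neg[OF this]
    show "((\<lambda>z. primitive V x z *v - F (s - z)) has_integral
      primitive V x s *v antiderivative F (s - s) - primitive V x 0 *v antiderivative F (s - 0)
        - causal_convolution (primitive V) F x s) {0..s}"
      by (simp add: antiderivative_nonpos primitive_nonpos bounded_bilinear.minus_right[OF bounded_bilinear_matrix_vector_mult]
          bounded_bilinear.zero_left[OF bounded_bilinear_matrix_vector_mult]
          bounded_bilinear.zero_right[OF bounded_bilinear_matrix_vector_mult])
  qed
  then show ?thesis by (simp add: causal_convolution_def integral_unique)
qed (simp add: causal_convolution_nonpos)

text \<open>The primitive is zero up to \<open>z = c\<close>, so the integral effectively starts
  there and a shift by \<open>c\<close> remains. The two terms of a strip are such delayed
  primitives.\<close>

lemma causal_convolution_delay:
  assumes V: "cont2 V" and F: "causal F" and c: "0 \<le> c"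
  shows "integral {0..s} (\<lambda>z. primitive V y (z - c) *v F (s - z)) = causal_convolution V (antiderivative F) y (s - c)"
proof -
  have zero: "integral {0..u} (\<lambda>z. primitive V y (z - c) *v F (s - z)) = 0" if "u \<le> c" for u
  proof -
    have "integral {0..u} (\<lambda>z. primitive V y (z - c) *v F (s - z)) = integral {0..u} (\<lambda>z. 0)"
      using that by (intro Henstock_Kurzweil_Integration.integral_cong)
        (simp add: primitive_nonpos bounded_bilinear.zero_left[OF bounded_bilinear_matrix_vector_mult])
    then show ?thesis by simp
  qed
  show ?thesis
  proof (cases "s \<le> c")
    case True
    then show ?thesis by (simp add: zero causal_convolution_nonpos)
  next
    case False
    have "integral {0..c} (\<lambda>z. primitive V y (z - c) *v F (s - z)) + integral {c..s} (\<lambda>z. primitive V y (z - c) *v F (s - z))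
        = integral {0..s} (\<lambda>z. primitive V y (z - c) *v F (s - z))"
      using c False
      by (intro Henstock_Kurzweil_Integration.integral_combine integrable_continuous_interval continuous_intros
          continuous_on_cont2[OF cont2_primitive[OF V]] continuous_on_causal[OF F]) auto
    then have "integral {0..s} (\<lambda>z. primitive V y (z - c) *v F (s - z))
        = integral {c..s} (\<lambda>z. primitive V y (z - c) *v F (s - z))"
      by (simp add: zero)
    also have "\<dots> = causal_convolution (primitive V) F y (s - c)"
      using integral_shift_Icc_real[of 0 "s - c" "\<lambda>z. primitive V y (z - c) *v F (s - z)" c]
      by (simp add: causal_convolution_def o_def algebra_simps)
    finally show ?thesis by (simp add: causal_convolution_primitive[OF V F])
  qed
qed

text \<open>For the source term of the Goursat equation: with \<open>y\<close> fixed, the range of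
  \<open>q\<close> in that term becomes a window for the kernel variable \<open>z\<close>. A part of
  the window beyond \<open>s\<close> is harmless, as the antiderivative vanishes for the
  corresponding nonpositive arguments.\<close>

lemma integral_window:
  assumes F: "causal F" and c: "0 \<le> c" "c \<le> d"
  shows "integral {0..s} (\<lambda>z. if c \<le> z \<and> z \<le> d then F (s - z) else 0) = antiderivative F (s - c) - antiderivative F (s - d)"
proof -
  have ftc: "integral {a..b} (\<lambda>z. F (s - z)) = antiderivative F (s - a) - antiderivative F (s - b)" if "a \<le> b" for a b
  proof -
    have "((\<lambda>z. F (s - z)) has_integral (- antiderivative F (s - b) - - antiderivative F (s - a))) {a..b}"
    proof (rule fundamental_theorem_of_calculus[OF that])
      fix z
      show "((\<lambda>z. - antiderivative F (s - z)) has_vector_derivative F (s - z)) (at z within {a..b})"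
      proof (rule has_vector_derivative_at_within)
        have "((\<lambda>z. s - z) has_real_derivative - 1) (at z)" by (auto intro!: derivative_eq_intros)
        from has_vector_derivative_minus[OF antiderivative_chain[OF F this]]
        show "((\<lambda>z. - antiderivative F (s - z)) has_vector_derivative F (s - z)) (at z)" by simp
      qed
    qed
    then show ?thesis by (simp add: integral_unique)
  qed
  have "integral {0..s} (\<lambda>z. if c \<le> z \<and> z \<le> d then F (s - z) else 0)
      = integral {0..s} (\<lambda>z. if z \<in> {c..d} then F (s - z) else 0)" by simp
  also have "\<dots> = integral ({c..d} \<inter> {0..s}) (\<lambda>z. F (s - z))"
    by (rule Henstock_Kurzweil_Integration.integral_restrict_Int)
  also have "{c..d} \<inter> {0..s} = {c..min d s}" using c by auto
  also have "integral {c..min d s} (\<lambda>z. F (s - z)) = antiderivative F (s - c) - antiderivative F (s - d)"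
  proof (cases "c \<le> s")
    case True
    then show ?thesis using c by (cases "d \<le> s") (auto simp: ftc antiderivative_nonpos)
  next
    case False
    then show ?thesis using c by (simp add: antiderivative_nonpos)
  qed
  finally show ?thesis .
qed

section \<open>The response to a boundary control\<close>

text \<open>It is defined for all real \<open>x\<close> and \<open>t\<close>, because d'Alembert's
  formula evaluates it at the reflected time \<open>t - x - y\<close>, which may be negative;
  causality makes it zero there when \<open>y \<ge> 0\<close>.\<close>

definition response ::
  "(real \<Rightarrow> real \<Rightarrow> complex^'n^'n) \<Rightarrow> (real \<Rightarrow> complex^'n) \<Rightarrow> real \<Rightarrow> real \<Rightarrow> complex^'n" where
  "response V F x t = F (t - x) + causal_convolution V F x (t - x)"

lemma response_eq_0: "causal F \<Longrightarrow> t \<le> x \<Longrightarrow> response V F x t = 0"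
  by (simp add: response_def causal_def causal_convolution_nonpos)

lemma cont2_response:
  assumes "cont2 V" "causal F"
  shows "cont2 (response V F)"
  unfolding response_def split_beta'
  by (intro continuous_intros continuous_on_causal[OF assms(2)]
      continuous_on_cont2[OF cont2_causal_convolution[OF assms]])

lemma response_has_vector_derivative:
  assumes V: "cont2 V" and F: "causal F" and u: "(u has_real_derivative c) (at z)"
  shows "((\<lambda>z. response V (antiderivative F) x (u z)) has_vector_derivative c *\<^sub>R response V F x (u z)) (at z)"
proof -
  have "((\<lambda>z. u z - x) has_real_derivative c) (at z)" using u by (auto intro!: derivative_eq_intros)
  from has_vector_derivative_add[OF antiderivative_chain[OF F this]
      antiderivative_chain[OF causal_section[OF V F] this]]
  show ?thesis
    unfolding response_def causal_convolution_antiderivative[OF V F] by (simp add: scaleR_add_right)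
qed

lemma integral_restricted_matrix_vector:
  fixes q :: "real \<Rightarrow> complex^'n^'n"
  assumes q: "q integrable_on {a..b}" and sub: "0 \<le> a" "b \<le> t"
  shows "((\<lambda>y. q y *v (if a \<le> y \<and> y \<le> b then w else 0)) has_integral integral {a..b} q *v w) {0..t}"
proof -
  interpret mv: bounded_bilinear "(*v) :: complex^'n^'n \<Rightarrow> complex^'n \<Rightarrow> complex^'n"
    by (rule bounded_bilinear_matrix_vector_mult)
  have "((\<lambda>y. q y *v w) has_integral integral {a..b} q *v w) {a..b}"
    using has_integral_linear[OF integrable_integral[OF q] mv.bounded_linear_left[of w]] by (simp add: o_def)
  then have "((\<lambda>y. if y \<in> {a..b} then q y *v w else 0) has_integral integral {a..b} q *v w) {0..t}"
    by (subst has_integral_restrict) (use sub in auto)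
  moreover have "(\<lambda>y. if y \<in> {a..b} then q y *v w else 0) = (\<lambda>y. q y *v (if a \<le> y \<and> y \<le> b then w else 0))"
    by (auto simp: fun_eq_iff mv.zero_right)
  ultimately show ?thesis by simp
qed

text \<open>Source and operator are combined under one integral over the fixed range from 0 to
  \<open>t\<close>, so that a single application of Fubini's theorem suffices after multiplication
  by values of \<open>F\<close>.\<close>

lemma goursat_kernel_apply:
  fixes q :: "real \<Rightarrow> complex^'n^'n"
  assumes q: "L1_loc q" and V: "cont2 V"
    and eqV: "V x s = goursat_source q x s - goursat_operator q V x s"
    and xs: "0 \<le> x" "0 \<le> s" "x + s / 2 \<le> t"
  shows "V x s *v w = - ((1/2) *\<^sub>R integral {0..t} (\<lambda>y. q y *v
           ((if s / 2 \<le> y \<and> y \<le> s / 2 + x then w else 0) + strip V x s y *v w)))"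
proof -
  interpret mv: bounded_bilinear "(*v) :: complex^'n^'n \<Rightarrow> complex^'n \<Rightarrow> complex^'n"
    by (rule bounded_bilinear_matrix_vector_mult)
  have 1: "((\<lambda>y. q y *v (if s / 2 \<le> y \<and> y \<le> s / 2 + x then w else 0)) has_integral
      integral {s / 2..s / 2 + x} q *v w) {0..t}"
    using xs by (intro integral_restricted_matrix_vector L1_loc_integrable[OF q]) auto
  have "((\<lambda>y. q y ** strip V x s y) has_integral 2 *\<^sub>R goursat_operator q V x s) {0..t}"
    using integrable_integral[OF integrable_goursat_operator[OF q V, of x s t]]
      goursat_operator_eq[OF q V xs] by simp
  from has_integral_linear[OF this mv.bounded_linear_left[of w]]
  have 2: "((\<lambda>y. q y *v (strip V x s y *v w)) has_integral 2 *\<^sub>R goursat_operator q V x s *v w) {0..t}"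
    by (simp add: o_def matrix_vector_mul_assoc)
  have "integral {0..t} (\<lambda>y. q y *v ((if s / 2 \<le> y \<and> y \<le> s / 2 + x then w else 0) + strip V x s y *v w))
      = integral {s / 2..s / 2 + x} q *v w + 2 *\<^sub>R goursat_operator q V x s *v w"
    using has_integral_add[OF 1 2] by (simp add: integral_unique mv.add_right)
  then show ?thesis
    by (simp add: eqV goursat_source_def mv.diff_left mv.minus_left mv.scaleR_left scaleR_add_right)
qed

text \<open>This is the Goursat equation convolved with \<open>F\<close>; the second term is the reflection at \<open>x = 0\<close>.\<close>

lemma response_equation:
  fixes q :: "real \<Rightarrow> complex^'n^'n"
  assumes q: "L1_loc q" and V: "cont2 V"
    and eqV: "\<And>x s. 0 \<le> x \<Longrightarrow> 0 \<le> s \<Longrightarrow> V x s = goursat_source q x s - goursat_operator q V x s"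
    and F: "causal F" and xt: "0 \<le> x" "x \<le> t"
  shows "response V F x t = F (t - x) - (1/2) *\<^sub>R integral {0..t} (\<lambda>y. q y *v
      (response V (antiderivative F) y (t - \<bar>x - y\<bar>) - response V (antiderivative F) y (t - x - y)))"
proof -
  interpret mv: bounded_bilinear "(*v) :: complex^'n^'n \<Rightarrow> complex^'n \<Rightarrow> complex^'n"
    by (rule bounded_bilinear_matrix_vector_mult)
  define s where "s = t - x"
  have s: "0 \<le> s" using xt by (simp add: s_def)
  \<comment> \<open>\<open>m1\<close> comes from the source and \<open>m2\<close> from the integral
    operator; both are multiplied by the same \<open>q y\<close>.\<close>
  define m1 where "m1 = (\<lambda>y z. if z / 2 \<le> y \<and> y \<le> z / 2 + x then F (s - z) else 0)"
  define m2 where "m2 = (\<lambda>y z. strip V x z y *v F (s - z))"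
  define m where "m = (\<lambda>y z. m1 y z + m2 y z)"
  have c1: "cont2 (\<lambda>(y::real) z. F (s - z))"
    unfolding split_beta' by (intro continuous_on_causal[OF F] continuous_intros)
  have c2: "cont2 m2"
    unfolding m2_def strip_def split_beta'
    by (intro continuous_intros continuous_on_causal[OF F] continuous_on_cont2[OF cont2_primitive[OF V]])
  have m_borel: "(\<lambda>(y, z). m y z) \<in> borel_measurable borel"
  proof -
    have "closed {p :: real \<times> real. snd p / 2 \<le> fst p \<and> fst p \<le> snd p / 2 + x}"
      by (intro closed_Collect_conj closed_Collect_le continuous_intros) auto
    then have "{p \<in> space borel. snd p / 2 \<le> fst p \<and> fst p \<le> snd p / 2 + x} \<in> sets borel"
      by (simp add: borel_closed)
    then have "(\<lambda>p. m1 (fst p) (snd p)) \<in> borel_measurable borel"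
      unfolding m1_def using c1
      by (intro measurable_If borel_measurable_continuous_onI) (simp_all add: split_beta')
    moreover have "(\<lambda>p. m2 (fst p) (snd p)) \<in> borel_measurable borel"
      using borel_measurable_continuous_onI[OF c2] by (simp add: split_beta')
    ultimately show ?thesis unfolding m_def split_beta' by (rule borel_measurable_add)
  qed
  obtain B1 where B1: "\<And>y z. y \<in> {0..t} \<Longrightarrow> z \<in> {0..s} \<Longrightarrow> norm (F (s - z)) \<le> B1"
    using bounded_cont2[OF c1] by metis
  obtain B2 where B2: "\<And>y z. y \<in> {0..t} \<Longrightarrow> z \<in> {0..s} \<Longrightarrow> norm (m2 y z) \<le> B2"
    using bounded_cont2[OF c2] by metis
  have m_bound: "norm (m y z) \<le> \<bar>B1\<bar> + B2" if yz: "y \<in> {0..t}" "z \<in> {0..s}" for y z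
  proof -
    have "norm (m1 y z) \<le> \<bar>B1\<bar>" using order_trans[OF B1[OF yz] abs_ge_self] by (simp add: m1_def)
    then show ?thesis unfolding m_def using B2[OF yz] by (intro norm_triangle_le) simp
  qed
  have m_int: "integral {0..s} (m y) = response V (antiderivative F) y (t - \<bar>x - y\<bar>)
      - response V (antiderivative F) y (t - x - y)" if y: "y \<in> {0..t}" for y
  proof -
    \<comment> \<open>The same two delays govern both terms: for nonnegative \<open>z\<close>, the
      window of \<open>m1\<close> is c \<le> z \<le> 2 y, and the strip in \<open>m2\<close> is a
      difference of primitives delayed by \<open>c\<close> and \<open>2 * y\<close>. The window
      supplies the antiderivative of \<open>F\<close> itself, the strip its convolution with
      \<open>V\<close>, and together they form a response at each delay. In the original variables
      the delays are the direct path t - |x - y| and the path t - x - y reflected at the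
      origin.\<close>
    define c where "c = max 0 (2 * y - 2 * x)"
    have c: "0 \<le> c" "c \<le> 2 * y" using y xt by (auto simp: c_def)
    have mc: "m1 y z = (if c \<le> z \<and> z \<le> 2 * y then F (s - z) else 0)" if "z \<in> {0..s}" for z
      using that by (auto simp: m1_def c_def)
    have w1: "integral {0..s} (m1 y) = antiderivative F (s - c) - antiderivative F (s - 2 * y)"
      unfolding integral_window[OF F c, symmetric]
      by (rule Henstock_Kurzweil_Integration.integral_cong) (rule mc)
    have m2_split: "m2 y z = primitive V y (z - c) *v F (s - z) - primitive V y (z - 2 * y) *v F (s - z)" for z
    proof -
      have "min z (z + 2 * x - 2 * y) = z - c" by (auto simp: c_def)
      then show ?thesis by (simp add: m2_def strip_def mv.diff_left)
    qed
    have pint: "(\<lambda>z. primitive V y (z - c') *v F (s - z)) integrable_on {0..s}" for c'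
      by (intro integrable_continuous_interval continuous_intros
          continuous_on_cont2[OF cont2_primitive[OF V]] continuous_on_causal[OF F])
    have w2: "integral {0..s} (m2 y) = causal_convolution V (antiderivative F) y (s - c)
        - causal_convolution V (antiderivative F) y (s - 2 * y)"
      unfolding m2_split using c pint
      by (simp add: Henstock_Kurzweil_Integration.integral_diff causal_convolution_delay[OF V F])
    have m1i: "m1 y integrable_on {0..s}"
    proof -
      have "(\<lambda>z. F (s - z)) integrable_on ({c..2 * y} \<inter> {0..s})"
        by (simp add: Int_atLeastAtMost)
          (intro integrable_continuous_interval continuous_on_causal[OF F] continuous_intros)
      then have "(\<lambda>z. if z \<in> {c..2 * y} then F (s - z) else 0) integrable_on {0..s}"
        by (simp only: integrable_restrict_Int)
      then show ?thesis
        by (rule integrable_eq) (simp add: mc)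
    qed
    have m2i: "m2 y integrable_on {0..s}"
      unfolding m2_split by (intro integrable_diff pint)
    have "integral {0..s} (m y) = integral {0..s} (m1 y) + integral {0..s} (m2 y)"
      unfolding m_def by (rule Henstock_Kurzweil_Integration.integral_add[OF m1i m2i])
    moreover have "t - \<bar>x - y\<bar> - y = s - c" "t - x - y - y = s - 2 * y"
      by (auto simp: s_def c_def)
    ultimately show ?thesis by (simp add: w1 w2 response_def)
  qed
  have "causal_convolution V F x s = integral {0..s} (\<lambda>z. - ((1/2) *\<^sub>R integral {0..t} (\<lambda>y. q y *v m y z)))"
    unfolding causal_convolution_def
  proof (rule Henstock_Kurzweil_Integration.integral_cong)
    fix z assume z: "z \<in> {0..s}"
    then have "x + z / 2 \<le> t" "0 \<le> z" using xt by (auto simp: s_def)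
    from goursat_kernel_apply[OF q V eqV[OF xt(1) this(2)] xt(1) this(2,1), of "F (s - z)"]
    show "V x z *v F (s - z) = - ((1/2) *\<^sub>R integral {0..t} (\<lambda>y. q y *v m y z))"
      by (simp add: m_def m1_def m2_def)
  qed
  also have "\<dots> = - ((1/2) *\<^sub>R integral {0..s} (\<lambda>z. integral {0..t} (\<lambda>y. q y *v m y z)))"
    by simp
  also have "integral {0..s} (\<lambda>z. integral {0..t} (\<lambda>y. q y *v m y z))
      = integral {0..t} (\<lambda>y. q y *v integral {0..s} (m y))"
    by (rule fubini_weighted(2)[OF bounded_bilinear_matrix_vector_mult L1_locD[OF q] m_borel m_bound])
  also have "\<dots> = integral {0..t} (\<lambda>y. q y *v
      (response V (antiderivative F) y (t - \<bar>x - y\<bar>) - response V (antiderivative F) y (t - x - y)))"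
    by (intro Henstock_Kurzweil_Integration.integral_cong) (simp add: m_int)
  finally show ?thesis by (simp add: response_def[of V F] s_def)
qed

section \<open>Integration across the corner of the travel time\<close>

lemma DERIV_reflected_distance:
  fixes t y z :: real
  assumes "z \<noteq> y"
  shows "((\<lambda>z. t - \<bar>z - y\<bar>) has_real_derivative - sgn (z - y)) (at z)"
proof (cases "y < z")
  case True
  have "((\<lambda>z. t - (z - y)) has_real_derivative - sgn (z - y)) (at z)"
    using True by (auto intro!: derivative_eq_intros)
  then show ?thesis
    by (rule has_field_derivative_transform_within_open[of _ _ _ "{y<..}"]) (use True in auto)
next
  case False
  have "((\<lambda>z. t - (y - z)) has_real_derivative - sgn (z - y)) (at z)"
    using False assms by (auto intro!: derivative_eq_intros)
  then show ?thesis
    by (rule has_field_derivative_transform_within_open[of _ _ _ "{..<y}"]) (use False assms in auto)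
qed

text \<open>Off \<open>z = y\<close> the integrand is the derivative of - H(t - |z - y|). This
  function is continuous across the corner, so the fundamental theorem with one exceptional point
  applies. It serves for the first integration in \<open>x\<close>.\<close>

lemma fold_has_integral:
  fixes H h :: "real \<Rightarrow> 'a::banach"
  assumes H: "\<And>z. (H has_vector_derivative h z) (at z)" and x: "0 \<le> x"
  shows "((\<lambda>z. sgn (z - y) *\<^sub>R h (t - \<bar>z - y\<bar>)) has_integral (H (t - \<bar>y\<bar>) - H (t - \<bar>x - y\<bar>))) {0..x}"
proof -
  have cH: "continuous_on UNIV H"
    using H by (intro continuous_at_imp_continuous_on) (auto intro: has_vector_derivative_continuous)
  have "((\<lambda>z. sgn (z - y) *\<^sub>R h (t - \<bar>z - y\<bar>)) has_integral (- H (t - \<bar>x - y\<bar>) - - H (t - \<bar>0 - y\<bar>))) {0..x}"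
  proof (rule fundamental_theorem_of_calculus_interior_strong[of "{y}"])
    fix z assume "z \<in> {0<..<x} - {y}"
    then have "((\<lambda>z. t - \<bar>z - y\<bar>) has_real_derivative - sgn (z - y)) (at z)"
      by (intro DERIV_reflected_distance) simp
    from has_vector_derivative_minus[OF has_vector_derivative_chain_real[OF H this]]
    show "((\<lambda>z. - H (t - \<bar>z - y\<bar>)) has_vector_derivative sgn (z - y) *\<^sub>R h (t - \<bar>z - y\<bar>)) (at z)"
      by simp
  next
    show "continuous_on {0..x} (\<lambda>z. - H (t - \<bar>z - y\<bar>))"
      by (intro continuous_on_minus continuous_on_compose2[OF cH] continuous_intros) auto
  qed (use x in auto)
  then show ?thesis by simp
qed

text \<open>For the second integration the natural antiderivative contains the discontinuous sign.
  Subtracting the corner value \<open>H t\<close> restores continuity at \<open>z = y\<close>, and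
  the surviving multiples of \<open>H t\<close> are the origin of the term with \<open>q\<close> in
  the wave equation.\<close>

lemma fold_sgn_has_integral:
  fixes H h :: "real \<Rightarrow> 'a::banach"
  assumes H: "\<And>z. (H has_vector_derivative h z) (at z)" and x: "0 \<le> x"
  shows "((\<lambda>z. h (t - \<bar>z - y\<bar>)) has_integral
    (sgn (- y) *\<^sub>R (H (t - \<bar>y\<bar>) - H t) - sgn (x - y) *\<^sub>R (H (t - \<bar>x - y\<bar>) - H t))) {0..x}"
proof -
  have cH: "continuous_on UNIV H"
    using H by (intro continuous_at_imp_continuous_on) (auto intro: has_vector_derivative_continuous)
  define \<phi> where "\<phi> = (\<lambda>z. - (sgn (z - y) *\<^sub>R (H (t - \<bar>z - y\<bar>) - H t)))"
  have "((\<lambda>z. h (t - \<bar>z - y\<bar>)) has_integral (\<phi> x - \<phi> 0)) {0..x}"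
  proof (rule fundamental_theorem_of_calculus_interior_strong[of "{y}"])
    fix z assume z: "z \<in> {0<..<x} - {y}"
    then have sg: "((\<lambda>z. t - \<bar>z - y\<bar>) has_real_derivative - sgn (z - y)) (at z)"
      by (intro DERIV_reflected_distance) simp
    have "((\<lambda>u. - (sgn (z - y) *\<^sub>R (H (t - \<bar>u - y\<bar>) - H t))) has_vector_derivative
        - (sgn (z - y) *\<^sub>R ((- sgn (z - y)) *\<^sub>R h (t - \<bar>z - y\<bar>) - 0))) (at z)"
      by (intro has_vector_derivative_minus bounded_linear.has_vector_derivative[OF bounded_linear_scaleR_right]
          has_vector_derivative_diff has_vector_derivative_chain_real[OF H sg] has_vector_derivative_const)
    also have "- (sgn (z - y) *\<^sub>R ((- sgn (z - y)) *\<^sub>R h (t - \<bar>z - y\<bar>) - 0)) = h (t - \<bar>z - y\<bar>)"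
      using z by (auto simp: sgn_if)
    finally show "(\<phi> has_vector_derivative h (t - \<bar>z - y\<bar>)) (at z)"
    proof (rule has_vector_derivative_transform_within_open[of _ _ _ "if y < z then {y<..} else {..<y}"])
      show "- (sgn (z - y) *\<^sub>R (H (t - \<bar>u - y\<bar>) - H t)) = \<phi> u" if "u \<in> (if y < z then {y<..} else {..<y})" for u
        using that z by (auto simp: \<phi>_def sgn_if split: if_splits)
    qed (use z in \<open>auto split: if_splits\<close>)
  next
    \<comment> \<open>This form without signs exhibits continuity at the corner: on either side one
      of the two minima is \<open>t\<close>.\<close>
    have "\<phi> = (\<lambda>z. - (H (min t (t - (z - y))) - H (min t (t - (y - z)))))"
      by (auto simp: fun_eq_iff \<phi>_def sgn_if min_def)
    then show "continuous_on {0..x} \<phi>"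
      by (simp only:) (intro continuous_intros continuous_on_compose2[OF cH], auto)
  qed (use x in auto)
  moreover have "\<phi> x - \<phi> 0 = sgn (- y) *\<^sub>R (H (t - \<bar>y\<bar>) - H t) - sgn (x - y) *\<^sub>R (H (t - \<bar>x - y\<bar>) - H t)"
    by (simp add: \<phi>_def algebra_simps)
  ultimately show ?thesis by metis
qed

text \<open>The formula for \<open>F\<close> contains the response to its antiderivative
  \<open>\<Phi>\<close>. Differentiating that in \<open>x\<close> gives a response to
  \<open>F\<close> with a sign, and once more a response to \<open>F1\<close>, which is what the
  formula for \<open>G\<close> contains. Everything is stated through integrals, since the second
  derivative contains \<open>q\<close> and is merely integrable.\<close>

lemma response_space_regularity:
  fixes q :: "real \<Rightarrow> complex^'n^'n" and t :: real
  assumes q: "L1_loc q" and V: "cont2 V"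
    and eqV: "\<And>x s. 0 \<le> x \<Longrightarrow> 0 \<le> s \<Longrightarrow> V x s = goursat_source q x s - goursat_operator q V x s"
    and G: "causal G"
  defines "F \<equiv> antiderivative (antiderivative G)"
  defines "u'' \<equiv> \<lambda>z. response V G z t + q z *v response V F z t"
  shows "u'' absolutely_integrable_on {0..t} \<and>
    (\<exists>u'. (\<forall>x\<in>{0..t}. response V F x t = F t + integral {0..x} u') \<and>
          (\<forall>x\<in>{0..t}. u' x = u' 0 + integral {0..x} u''))"
proof -
  interpret mv: bounded_bilinear "(*v) :: complex^'n^'n \<Rightarrow> complex^'n \<Rightarrow> complex^'n"
    by (rule bounded_bilinear_matrix_vector_mult)
  define F1 where "F1 = antiderivative G"
  define \<Phi> where "\<Phi> = antiderivative F"
  have F1: "causal F1" and F: "causal F" and \<Phi>: "causal \<Phi>"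
    unfolding F1_def F_def \<Phi>_def by (intro causal_antiderivative G)+
  have F_eq: "F = antiderivative F1" by (simp add: F_def F1_def)
  have prod_int: "(\<lambda>y. q y *v g y) integrable_on {0..t}" if "continuous_on {0..t} g" for g
    using absolutely_integrable_continuous_product[OF bounded_bilinear_matrix_vector_mult L1_locD[OF q] that]
    by (simp add: absolutely_integrable_on_def)
  have r_cont: "continuous_on S (\<lambda>p. response V A (f p) (g p))"
    if "causal A" "continuous_on S f" "continuous_on S g" for A S and f g :: "'p::topological_space \<Rightarrow> real"
    by (rule continuous_on_cont2[OF cont2_response[OF V that(1)] that(2,3)])
  \<comment> \<open>Off the corner, \<open>- m y z\<close> is the derivative in \<open>z\<close> of
    the integrand in the formula for \<open>F\<close> at the point \<open>z\<close>, and
    \<open>- k y z\<close> is the derivative of \<open>m y z\<close>. At the same time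
    \<open>k\<close> is the integrand in the formula for \<open>G\<close>.\<close>
  define m where "m = (\<lambda>y z. sgn (z - y) *\<^sub>R response V F y (t - \<bar>z - y\<bar>) - response V F y (t - z - y))"
  define k where "k = (\<lambda>y z. response V F1 y (t - \<bar>z - y\<bar>) - response V F1 y (t - z - y))"
  have k_cont: "cont2 k"
    unfolding k_def split_beta' by (intro continuous_intros r_cont F1)
  have a_cont: "cont2 (\<lambda>y z. response V F y (t - \<bar>z - y\<bar>))" and b_cont: "cont2 (\<lambda>y z. response V F y (t - z - y))"
    unfolding split_beta' by (intro continuous_intros r_cont F)+
  have m_borel: "(\<lambda>(y, z). m y z) \<in> borel_measurable borel"
  proof -
    have sg: "(\<lambda>p :: real \<times> real. sgn (snd p - fst p)) \<in> borel_measurable borel"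
      by (intro measurable_compose[OF _ borel_measurable_sgn] borel_measurable_continuous_onI continuous_intros)
    show ?thesis
      unfolding m_def split_beta'
      using borel_measurable_continuous_onI[OF a_cont] borel_measurable_continuous_onI[OF b_cont] sg
      by (intro borel_measurable_diff borel_measurable_scaleR) (simp_all add: split_beta')
  qed
  obtain B1 where B1: "\<And>y z. y \<in> {0..t} \<Longrightarrow> z \<in> {0..t} \<Longrightarrow> norm (response V F y (t - \<bar>z - y\<bar>)) \<le> B1"
    using bounded_cont2[OF a_cont] by metis
  obtain B2 where B2: "\<And>y z. y \<in> {0..t} \<Longrightarrow> z \<in> {0..t} \<Longrightarrow> norm (response V F y (t - z - y)) \<le> B2"
    using bounded_cont2[OF b_cont] by metis
  have m_bound: "norm (m y z) \<le> \<bar>B1\<bar> + \<bar>B2\<bar>" if "y \<in> {0..t}" "z \<in> {0..t}" for y z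
  proof -
    have "norm (sgn (z - y) *\<^sub>R response V F y (t - \<bar>z - y\<bar>)) \<le> \<bar>B1\<bar>"
      using B1[OF that] by (auto simp: sgn_if)
    moreover have "norm (response V F y (t - z - y)) \<le> \<bar>B2\<bar>" using B2[OF that] by simp
    ultimately show ?thesis
      unfolding m_def by (intro order_trans[OF norm_triangle_ineq4]) simp
  qed
  obtain B3 where B3: "\<And>y z. y \<in> {0..t} \<Longrightarrow> z \<in> {0..t} \<Longrightarrow> norm (k y z) \<le> B3"
    using bounded_cont2[OF k_cont] by metis
  have dF: "(response V F y has_vector_derivative response V F1 y z) (at z)" for y z
    using response_has_vector_derivative[OF V F1 DERIV_ident] by (simp add: F_eq)
  have d\<Phi>: "(response V \<Phi> y has_vector_derivative response V F y z) (at z)" for y z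
    using response_has_vector_derivative[OF V F DERIV_ident] by (simp add: \<Phi>_def)
  have shift: "((\<lambda>z. response V A1 y (t - z - y)) has_integral (response V A y (t - y) - response V A y (t - x - y))) {0..x}"
    if "0 \<le> x" "\<And>z. (response V A y has_vector_derivative response V A1 y z) (at z)" for A A1 x y
  proof -
    have "((\<lambda>z. response V A1 y (t - z - y)) has_integral (- response V A y (t - x - y) - - response V A y (t - 0 - y))) {0..x}"
    proof (rule fundamental_theorem_of_calculus[OF that(1)], rule has_vector_derivative_at_within)
      fix z
      have "((\<lambda>z. t - z - y) has_real_derivative - 1) (at z)" by (auto intro!: derivative_eq_intros)
      from has_vector_derivative_minus[OF has_vector_derivative_chain_real[OF that(2) this]]
      show "((\<lambda>z. - response V A y (t - z - y)) has_vector_derivative response V A1 y (t - z - y)) (at z)" by simp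
    qed
    then show ?thesis by simp
  qed
  have int_m: "integral {0..x} (m y) = - (response V \<Phi> y (t - \<bar>x - y\<bar>) - response V \<Phi> y (t - x - y))"
    if "0 \<le> x" "0 \<le> y" for x y
  proof -
    have "(m y has_integral (response V \<Phi> y (t - \<bar>y\<bar>) - response V \<Phi> y (t - \<bar>x - y\<bar>)
        - (response V \<Phi> y (t - y) - response V \<Phi> y (t - x - y)))) {0..x}"
      unfolding m_def by (rule has_integral_diff[OF fold_has_integral[OF d\<Phi> that(1)] shift[OF that(1) d\<Phi>]])
    then show ?thesis using that(2) by (simp add: integral_unique)
  qed
  \<comment> \<open>The term with factor 2 is the jump of the sign in \<open>m y\<close> at
    \<open>z = y\<close>, which lies in the range of integration exactly for \<open>y < x\<close>.
    The points \<open>y = 0\<close> and \<open>y = x\<close> are left out because there the sign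
    takes the value 0 at an end of the interval.\<close>
  have int_k: "integral {0..x} (k y) = m y 0 - m y x + (if y < x then 2 *\<^sub>R response V F y t else 0)"
    if "0 \<le> x" "0 < y" "y \<noteq> x" for x y
  proof -
    have "(k y has_integral (sgn (- y) *\<^sub>R (response V F y (t - \<bar>y\<bar>) - response V F y t)
        - sgn (x - y) *\<^sub>R (response V F y (t - \<bar>x - y\<bar>) - response V F y t)
        - (response V F y (t - y) - response V F y (t - x - y)))) {0..x}"
      unfolding k_def by (rule has_integral_diff[OF fold_sgn_has_integral[OF dF that(1)] shift[OF that(1) dF]])
    then show ?thesis using that(2,3)
      by (cases "y < x") (simp_all add: integral_unique m_def scaleR_2)
  qed
  define D where "D = (\<lambda>z. integral {0..t} (\<lambda>y. q y *v m y z))"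
  \<comment> \<open>The factor is + 1/2 because \<open>m\<close> is the negative of the derivative
    in question.\<close>
  define u' where "u' = (\<lambda>z. - F1 (t - z) + (1/2) *\<^sub>R D z)"
  have F1_int: "integral {0..x} (\<lambda>z. A1 (t - z)) = antiderivative A1 t - antiderivative A1 (t - x)"
    if "causal A1" "0 \<le> x" for A1 :: "real \<Rightarrow> complex^'n" and x
  proof -
    have "((\<lambda>z. A1 (t - z)) has_integral (- antiderivative A1 (t - x) - - antiderivative A1 (t - 0))) {0..x}"
    proof (rule fundamental_theorem_of_calculus[OF that(2)], rule has_vector_derivative_at_within)
      fix z
      have "((\<lambda>z. t - z) has_real_derivative - 1) (at z)" by (auto intro!: derivative_eq_intros)
      from has_vector_derivative_minus[OF antiderivative_chain[OF that(1) this]]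
      show "((\<lambda>z. - antiderivative A1 (t - z)) has_vector_derivative A1 (t - z)) (at z)" by simp
    qed
    then show ?thesis by (simp add: integral_unique)
  qed
  have A_int: "(\<lambda>z. A (t - z)) integrable_on {0..x}" if "causal A" for A :: "real \<Rightarrow> complex^'n" and x
    by (intro integrable_continuous_interval continuous_on_causal[OF that] continuous_intros)
  show ?thesis
  proof (intro conjI exI[of _ u'] ballI)
    fix x assume x: "x \<in> {0..t}"
    then have x0: "0 \<le> x" and xt: "x \<le> t" by auto
    have mb: "norm (m y z) \<le> \<bar>B1\<bar> + \<bar>B2\<bar>" if "y \<in> {0..t}" "z \<in> {0..x}" for y z
      using m_bound that xt by auto
    have D_int: "D integrable_on {0..x}"
      using fubini_weighted(1)[OF bounded_bilinear_matrix_vector_mult L1_locD[OF q] m_borel mb]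
      by (simp add: D_def absolutely_integrable_on_def)
    have D_eq: "integral {0..x} D = integral {0..t} (\<lambda>y. q y *v integral {0..x} (m y))"
      unfolding D_def
      by (rule fubini_weighted(2)[OF bounded_bilinear_matrix_vector_mult L1_locD[OF q] m_borel mb])
    have "response V F x t = F (t - x) - (1/2) *\<^sub>R integral {0..t} (\<lambda>y. q y *v
        (response V \<Phi> y (t - \<bar>x - y\<bar>) - response V \<Phi> y (t - x - y)))"
      unfolding \<Phi>_def by (rule response_equation[OF q V eqV F x0 xt])
    also have "integral {0..t} (\<lambda>y. q y *v (response V \<Phi> y (t - \<bar>x - y\<bar>) - response V \<Phi> y (t - x - y)))
        = integral {0..t} (\<lambda>y. - (q y *v integral {0..x} (m y)))"
      by (intro Henstock_Kurzweil_Integration.integral_cong) (simp add: int_m[OF x0] flip: mv.minus_right)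
    also have "\<dots> = - integral {0..x} D" by (simp add: D_eq)
    also have "F (t - x) - (1/2) *\<^sub>R (- integral {0..x} D) = F t + integral {0..x} u'"
    proof -
      have "integral {0..x} u' = integral {0..x} (\<lambda>z. - F1 (t - z)) + integral {0..x} (\<lambda>z. (1/2) *\<^sub>R D z)"
        unfolding u'_def
        by (intro Henstock_Kurzweil_Integration.integral_add integrable_neg A_int F1 integrable_cmul D_int)
      then show ?thesis using F1_int[OF F1 x0] by (simp add: F_eq)
    qed
    finally show "response V F x t = F t + integral {0..x} u'" .
  next
    have "(\<lambda>z. response V G z t) absolutely_integrable_on {0..t}"
      by (intro absolutely_integrable_continuous_real r_cont G continuous_intros)
    moreover have "(\<lambda>z. q z *v response V F z t) absolutely_integrable_on {0..t}"
      by (intro absolutely_integrable_continuous_product[OF bounded_bilinear_matrix_vector_mult L1_locD[OF q]]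
          r_cont F continuous_intros)
    ultimately show "u'' absolutely_integrable_on {0..t}"
      unfolding u''_def by (rule set_integral_add(1))
  next
    fix x assume x: "x \<in> {0..t}"
    \<comment> \<open>The first term stems from \<open>m y 0\<close>, where the direct and the
      reflected path coincide and add up to \<open>- 2\<close> times one response. It does not
      depend on \<open>x\<close> and cancels in the difference of \<open>u' x\<close> and
      \<open>u' 0\<close>.\<close>
    have D_formula: "D x = (- 2) *\<^sub>R integral {0..t} (\<lambda>y. q y *v response V F y (t - y))
        - integral {0..x} (\<lambda>z. integral {0..t} (\<lambda>y. q y *v k y z))
        + 2 *\<^sub>R integral {0..x} (\<lambda>y. q y *v response V F y t)" (is "_ = (- 2) *\<^sub>R ?I - ?J + 2 *\<^sub>R ?L")
      if x: "x \<in> {0..t}" for x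
    proof -
      have x0: "0 \<le> x" and xt: "x \<le> t" using x by auto
      have 1: "((\<lambda>y. (- 2) *\<^sub>R (q y *v response V F y (t - y))) has_integral (- 2) *\<^sub>R ?I) {0..t}"
        by (intro has_integral_cmul integrable_integral prod_int r_cont F continuous_intros)
      have kb: "norm (k y z) \<le> B3" if "y \<in> {0..t}" "z \<in> {0..x}" for y z
        using B3 that xt by auto
      have J: "?J = integral {0..t} (\<lambda>y. q y *v integral {0..x} (k y))"
        by (rule fubini_weighted(2)[OF bounded_bilinear_matrix_vector_mult L1_locD[OF q]
              borel_measurable_continuous_onI[OF k_cont] kb])
      have "continuous_on UNIV (\<lambda>y. integral {0..x} (k y))"
        by (intro continuous_on_integral_upto k_cont continuous_intros)
      then have 2: "((\<lambda>y. q y *v integral {0..x} (k y)) has_integral ?J) {0..t}"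
        unfolding J by (intro integrable_integral prod_int) (rule continuous_on_subset, auto)
      have "(\<lambda>y. q y *v response V F y t) integrable_on {0..x}"
        by (rule integrable_subinterval_real[of _ 0 t], rule prod_int)
          (use x in \<open>auto intro!: r_cont F continuous_intros\<close>)
      then have "((\<lambda>y. if y \<in> {0..x} then 2 *\<^sub>R (q y *v response V F y t) else 0) has_integral 2 *\<^sub>R ?L) {0..t}"
        using x by (subst has_integral_restrict) (auto intro!: has_integral_cmul integrable_integral)
      from has_integral_add[OF has_integral_diff[OF 1 2] this]
      have "((\<lambda>y. q y *v m y x) has_integral (- 2) *\<^sub>R ?I - ?J + 2 *\<^sub>R ?L) {0..t}"
      proof (rule has_integral_spike_finite[of "{0, x}", rotated 2])
        fix y assume y: "y \<in> {0..t} - {0, x}"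
        then have y': "0 < y" "y \<noteq> x" by auto
        have m0: "m y 0 = (- 2) *\<^sub>R response V F y (t - y)"
          using y' by (simp add: m_def scaleR_2)
        have "m y x = (- 2) *\<^sub>R response V F y (t - y) - integral {0..x} (k y)
            + (if y \<in> {0..x} then 2 *\<^sub>R response V F y t else 0)"
          using int_k[OF x0 y'] y' m0 by auto
        then show "q y *v m y x = (- 2) *\<^sub>R (q y *v response V F y (t - y)) - q y *v integral {0..x} (k y)
            + (if y \<in> {0..x} then 2 *\<^sub>R (q y *v response V F y t) else 0)"
          by (auto simp: mv.add_right mv.diff_right mv.scaleR_right mv.minus_right)
      qed simp
      then show ?thesis by (simp add: D_def integral_unique)
    qed
    have x0: "0 \<le> x" and xt: "x \<le> t" using x by auto
    have kb: "norm (k y z) \<le> B3" if "y \<in> {0..t}" "z \<in> {0..x}" for y z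
      using B3 that xt by auto
    have Ji: "(\<lambda>z. integral {0..t} (\<lambda>y. q y *v k y z)) integrable_on {0..x}"
      using fubini_weighted(1)[OF bounded_bilinear_matrix_vector_mult L1_locD[OF q]
              borel_measurable_continuous_onI[OF k_cont] kb]
      by (simp add: absolutely_integrable_on_def)
    have qF: "(\<lambda>z. q z *v response V F z t) integrable_on {0..x}"
      by (rule integrable_subinterval_real[of _ 0 t], rule prod_int)
        (use x in \<open>auto intro!: r_cont F continuous_intros\<close>)
    have Gi: "(\<lambda>z. response V G z t) integrable_on {0..x}"
      by (intro integrable_continuous_interval r_cont G continuous_intros)
    \<comment> \<open>The double integral of \<open>k\<close> left over from the two integrations is
      now recognised as the one in the formula for \<open>G\<close>.\<close>
    have "integral {0..x} (\<lambda>z. response V G z t)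
        = integral {0..x} (\<lambda>z. G (t - z) - (1/2) *\<^sub>R integral {0..t} (\<lambda>y. q y *v k y z))"
    proof (rule Henstock_Kurzweil_Integration.integral_cong)
      fix z assume "z \<in> {0..x}"
      then have "0 \<le> z" "z \<le> t" using xt by auto
      from response_equation[OF q V eqV G this]
      show "response V G z t = G (t - z) - (1/2) *\<^sub>R integral {0..t} (\<lambda>y. q y *v k y z)"
        by (simp add: k_def F1_def)
    qed
    also have "\<dots> = (F1 t - F1 (t - x)) - (1/2) *\<^sub>R integral {0..x} (\<lambda>z. integral {0..t} (\<lambda>y. q y *v k y z))"
      using Henstock_Kurzweil_Integration.integral_diff[OF A_int[OF G] integrable_cmul[OF Ji, of "1/2"]] F1_int[OF G x0]
      by (simp add: F1_def)
    finally have "integral {0..x} (\<lambda>z. response V G z t + q z *v response V F z t)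
        = (F1 t - F1 (t - x)) - (1/2) *\<^sub>R integral {0..x} (\<lambda>z. integral {0..t} (\<lambda>y. q y *v k y z))
          + integral {0..x} (\<lambda>y. q y *v response V F y t)"
      using Henstock_Kurzweil_Integration.integral_add[OF Gi qF] by simp
    moreover have "0 \<in> {0..t}" using x by auto
    ultimately show "u' x = u' 0 + integral {0..x} u''"
      unfolding u''_def u'_def D_formula[OF x] D_formula[OF \<open>0 \<in> {0..t}\<close>]
      by (simp add: algebra_simps)
  qed
qed

section \<open>Extension of the control by zero and assembly of the assertions\<close>

text \<open>The closed support keeps a positive distance from 0, so all derivatives of
  \<open>f\<close> vanish on some interval from 0 to \<open>\<delta>\<close>. Hence their extensions
  by zero are derivatives of one another on the whole line, and \<open>G\<close> is the extension of
  the second one.\<close>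

lemma zero_extension_eq_antiderivative_causal:
  fixes f :: "real \<Rightarrow> complex^'n"
  assumes f: "smooth_on_halfline f" and supp: "closure (support_on {0..} f) \<subseteq> {0<..}"
  obtains G where "causal G" "zero_extension f = antiderivative (antiderivative G)"
proof -
  obtain D :: "nat \<Rightarrow> real \<Rightarrow> complex^'n" where D0: "\<And>x. x \<ge> 0 \<Longrightarrow> D 0 x = f x"
    and D: "\<And>k x. x \<ge> 0 \<Longrightarrow> (D k has_vector_derivative D (Suc k) x) (at x within {0..})"
    using f unfolding smooth_on_halfline_def by blast
  have "open (- closure (support_on {0..} f))" "0 \<in> - closure (support_on {0..} f)"
    using supp by (auto simp: open_Compl)
  then obtain r where r: "r > 0" "ball 0 r \<subseteq> - closure (support_on {0..} f)"
    using open_contains_ball by blast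
  define \<delta> where "\<delta> = r / 2"
  have \<delta>: "\<delta> > 0" using r by (simp add: \<delta>_def)
  have f0: "f x = 0" if "x \<in> {0..\<delta>}" for x
  proof (rule ccontr)
    assume "f x \<noteq> 0"
    then have "x \<in> support_on {0..} f" using that by (simp add: support_on_def)
    then have "x \<in> closure (support_on {0..} f)" using closure_subset by (rule set_mp[rotated])
    moreover have "x \<in> ball 0 r" using that r(1) by (simp add: \<delta>_def)
    ultimately show False using r(2) by blast
  qed
  have Dz: "D k x = 0" if "x \<in> {0..\<delta>}" for k x
    using that
  proof (induction k arbitrary: x)
    case 0
    then show ?case using D0 f0 by simp
  next
    case (Suc k)
    \<comment> \<open>The derivative within the nondegenerate interval from 0 to
      \<open>\<delta>\<close> is unique also at its endpoints, so the one-sided derivative at 0 is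
      covered.\<close>
    have 1: "(D k has_vector_derivative D (Suc k) x) (at x within cbox 0 \<delta>)"
      by (rule has_vector_derivative_within_subset[OF D]) (use Suc.prems in auto)
    have 2: "(D k has_vector_derivative 0) (at x within cbox 0 \<delta>)"
      using has_vector_derivative_transform[OF Suc.prems Suc.IH has_vector_derivative_const] by simp
    show ?case
      by (rule vector_derivative_unique_within_closed_interval[OF \<delta> _ 1 2]) (use Suc.prems in simp)
  qed
  define E where "E = (\<lambda>k s. if s \<le> 0 then 0 else D k s)"
  have E: "(E k has_vector_derivative E (Suc k) s) (at s)" for k s
  proof (cases "s < \<delta>")
    case True
    have "E (Suc k) s = 0" using Dz[of s "Suc k"] True by (cases "s \<le> 0") (simp_all add: E_def)
    moreover have "(E k has_vector_derivative 0) (at s)"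
    proof (rule has_vector_derivative_transform_within_open)
      show "((\<lambda>_. 0 :: complex^'n) has_vector_derivative 0) (at s)" by (rule has_vector_derivative_const)
      show "open {..<\<delta>}" "s \<in> {..<\<delta>}" using True by simp_all
      show "0 = E k u" if "u \<in> {..<\<delta>}" for u
        using Dz[of u k] that by (cases "u \<le> 0") (simp_all add: E_def)
    qed
    ultimately show ?thesis by simp
  next
    case False
    then have s: "s > 0" using \<delta> by simp
    have "(D k has_vector_derivative D (Suc k) s) (at s within {0<..})"
      by (rule has_vector_derivative_within_subset[OF D]) (use s in auto)
    then have Dk: "(D k has_vector_derivative E (Suc k) s) (at s)"
      using s at_within_open[of s "{0<..}"] by (simp add: E_def)
    show ?thesis
    proof (rule has_vector_derivative_transform_within_open[OF Dk])
      show "open {0::real<..}" "s \<in> {0<..}" using s by simp_all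
      show "D k u = E k u" if "u \<in> {0<..}" for u using that by (simp add: E_def)
    qed
  qed
  have causal: "causal (E k)" for k
    unfolding causal_def
  proof
    show "continuous_on UNIV (E k)"
      by (intro continuous_at_imp_continuous_on ballI has_vector_derivative_continuous[OF E])
    show "\<forall>s\<le>0. E k s = 0" by (simp add: E_def)
  qed
  have anti: "E k = antiderivative (E (Suc k))" for k
  proof
    fix s
    show "E k s = antiderivative (E (Suc k)) s"
    proof (cases "0 \<le> s")
      case True
      have "(E (Suc k) has_integral (E k s - E k 0)) {0..s}"
        by (rule fundamental_theorem_of_calculus[OF True has_vector_derivative_at_within[OF E]])
      then have "antiderivative (E (Suc k)) s = E k s - E k 0" by (simp add: antiderivative_def integral_unique)
      then show ?thesis by (simp add: E_def)
    qed (simp add: antiderivative_nonpos E_def)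
  qed
  have "zero_extension f t = E 0 t" for t
    using D0[of t] f0[of 0] \<delta> by (cases "t < 0"; cases "t = 0") (simp_all add: zero_extension_def E_def)
  then have "zero_extension f = E 0" by blast
  also have "E 0 = antiderivative (antiderivative (E (Suc (Suc 0))))"
    unfolding anti[of 0, symmetric] anti[of "Suc 0", symmetric] ..
  finally show thesis by (rule that[OF causal])
qed

lemma wave_eq_response:
  assumes V: "\<And>x s. 0 \<le> x \<Longrightarrow> 0 \<le> s \<Longrightarrow> kernel_w q x (x + s) = V x s" and x: "0 \<le> x"
  shows "wave q f x t = response V (zero_extension f) x t"
proof -
  have "integral {x..t} (\<lambda>s. kernel_w q x s *v zero_extension f (t - s))
      = integral {0..t - x} (\<lambda>z. kernel_w q x (x + z) *v zero_extension f (t - (x + z)))"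
    using integral_shift_Icc_real[of 0 "t - x" "\<lambda>s. kernel_w q x s *v zero_extension f (t - s)" x]
    by (simp add: o_def)
  also have "\<dots> = integral {0..t - x} (\<lambda>z. V x z *v zero_extension f (t - x - z))"
    by (intro Henstock_Kurzweil_Integration.integral_cong) (simp add: V x diff_diff_eq)
  finally show ?thesis by (simp add: wave_def response_def causal_convolution_def)
qed

theorem theorem1:
  fixes q :: "real \<Rightarrow> complex^'n^'n"
    and f :: "real \<Rightarrow> complex^'n"
  assumes "L1_loc q"
    and "smooth_on_halfline f"
    and "closure (support_on {0..} f) \<subseteq> {0<..}"
  shows "(\<forall>t>0. AE x in lebesgue. x \<in> {0<..<t} \<longrightarrow>
            (\<exists>u_tt u_xx.
               has_second_derivative (\<lambda>\<tau>. wave q f x \<tau>) u_tt t \<and>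
               has_second_derivative (\<lambda>y. wave q f y t) u_xx x \<and>
               u_tt - u_xx + q x *v wave q f x t = 0))
       \<and> (\<forall>t\<ge>0. \<forall>x\<ge>t. wave q f x t = 0)
       \<and> (\<forall>t\<ge>0. wave q f 0 t = f t)
       \<and> (\<forall>t\<ge>0. sobolev_W21 t (\<lambda>x. wave q f x t))
       \<and> (\<forall>t\<ge>0. \<exists>g. continuous_on {0..t} g \<and>
            (AE x in lebesgue. x \<in> {0<..<t} \<longrightarrow>
              (\<exists>u_xx. has_second_derivative (\<lambda>y. wave q f y t) u_xx x \<and>
                      g x = - u_xx + q x *v wave q f x t)))"
proof -
  obtain V where V: "cont2 V"
    and "\<forall>x\<ge>0. \<forall>s\<ge>0. kernel_w q x (x + s) = V x s"
    and "\<forall>x\<ge>0. \<forall>s\<ge>0. V x s = goursat_source q x s - goursat_operator q V x s"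
    using kernel_w_characteristic_coordinates[OF assms(1)] by (elim exE conjE)
  then have kernel: "kernel_w q x (x + s) = V x s"
    and eqV: "V x s = goursat_source q x s - goursat_operator q V x s" if "0 \<le> x" "0 \<le> s" for x s
    using that by blast+
  obtain G where G: "causal G" and fG: "zero_extension f = antiderivative (antiderivative G)"
    by (rule zero_extension_eq_antiderivative_causal[OF assms(2,3)])
  define F1 where "F1 = antiderivative G"
  define F where "F = antiderivative F1"
  have F1: "causal F1" and F: "causal F"
    unfolding F1_def F_def by (intro causal_antiderivative G)+
  have wave: "wave q f x t = response V F x t" if "0 \<le> x" for x t
    using wave_eq_response[of q V, OF kernel that] by (simp add: fG F_def F1_def)
  have F_f: "F t = f t" if "0 \<le> t" for t
    using fun_cong[OF fG, of t] that by (simp add: zero_extension_def F_def F1_def)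
  have time: "has_second_derivative (\<lambda>\<tau>. wave q f x \<tau>) (response V G x t) t" if "0 \<le> x" for x t
  proof -
    have "(response V F x has_vector_derivative response V F1 x \<tau>) (at \<tau>)"
      "(response V F1 x has_vector_derivative response V G x \<tau>) (at \<tau>)" for \<tau>
      using response_has_vector_derivative[OF V F1 DERIV_ident, of x \<tau>]
        response_has_vector_derivative[OF V G DERIV_ident, of x \<tau>]
      unfolding F_def F1_def by simp_all
    then show ?thesis
      unfolding has_second_derivative_def wave[OF that] by (intro exI[of _ "response V F1 x"]) simp
  qed
  \<comment> \<open>The candidate for the second space derivative: the second time derivative, which
    is the response to \<open>G\<close>, plus the potential term.\<close>
  define u2 where "u2 = (\<lambda>t z. response V G z t + q z *v response V F z t)"
  have reg: "u2 t absolutely_integrable_on {0..t} \<and>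
      (\<exists>u'. (\<forall>x\<in>{0..t}. response V F x t = F t + integral {0..x} u') \<and>
            (\<forall>x\<in>{0..t}. u' x = u' 0 + integral {0..x} (u2 t)))" for t
    unfolding u2_def F_def F1_def by (rule response_space_regularity[OF assms(1) V eqV G])
  then have u2: "u2 t absolutely_integrable_on {0..t}" for t by (rule conjunct1)
  have "\<forall>t. \<exists>u'. (\<forall>x\<in>{0..t}. response V F x t = F t + integral {0..x} u') \<and>
      (\<forall>x\<in>{0..t}. u' x = u' 0 + integral {0..x} (u2 t))"
    using reg by (intro allI) (rule conjunct2)
  from choice[OF this] obtain u1 where
    u1: "\<forall>t. (\<forall>x\<in>{0..t}. response V F x t = F t + integral {0..x} (u1 t)) \<and>
      (\<forall>x\<in>{0..t}. u1 t x = u1 t 0 + integral {0..x} (u2 t))" ..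
  have u1_int: "response V F x t = F t + integral {0..x} (u1 t)" if "x \<in> {0..t}" for x t
    using u1 that by blast
  have u2_int: "u1 t x = u1 t 0 + integral {0..x} (u2 t)" if "x \<in> {0..t}" for x t
    using u1 that by blast
  have u2i: "u2 t integrable_on {0..t}" for t
    using u2 by (simp add: absolutely_integrable_on_def)
  have u1c: "continuous_on {0..t} (u1 t)" for t
  proof (rule continuous_on_eq)
    show "continuous_on {0..t} (\<lambda>x. u1 t 0 + integral {0..x} (u2 t))"
      by (intro continuous_intros indefinite_integral_continuous_1 u2i)
  qed (rule u2_int[symmetric])
  have dwave: "((\<lambda>x. wave q f x t) has_vector_derivative u1 t x) (at x within {0..t})" if x: "x \<in> {0..t}" for x t
  proof (rule has_vector_derivative_transform[OF x])
    show "wave q f y t = F t + integral {0..y} (u1 t)" if "y \<in> {0..t}" for y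
      using that by (simp add: wave u1_int)
    show "((\<lambda>y. F t + integral {0..y} (u1 t)) has_vector_derivative u1 t x) (at x within {0..t})"
      using has_vector_derivative_add[OF has_vector_derivative_const integral_has_vector_derivative[OF u1c x]] by simp
  qed
  have dwave_at: "((\<lambda>x. wave q f x t) has_vector_derivative u1 t x) (at x)" if "x \<in> {0<..<t}" for x t
    using dwave[of x t] that by (simp add: at_within_Icc_at)
  have du1: "AE x in lebesgue. x \<in> {0<..<t} \<longrightarrow> (u1 t has_vector_derivative u2 t x) (at x)" for t
    using indefinite_integral_has_vector_derivative_AE[OF u2i[of t]]
  proof eventually_elim
    fix x
    assume *: "x \<in> {0<..<t} \<longrightarrow> ((\<lambda>x. integral {0..x} (u2 t)) has_vector_derivative u2 t x) (at x)"
    show "x \<in> {0<..<t} \<longrightarrow> (u1 t has_vector_derivative u2 t x) (at x)"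
    proof
      assume x: "x \<in> {0<..<t}"
      have d: "((\<lambda>x. u1 t 0 + integral {0..x} (u2 t)) has_vector_derivative u2 t x) (at x)"
        using has_vector_derivative_add[OF has_vector_derivative_const mp[OF * x]] by simp
      show "(u1 t has_vector_derivative u2 t x) (at x)"
      proof (rule has_vector_derivative_transform_within_open[OF d])
        show "open {0<..<t}" "x \<in> {0<..<t}" using x by simp_all
        show "u1 t 0 + integral {0..y} (u2 t) = u1 t y" if "y \<in> {0<..<t}" for y
          using that by (intro u2_int[symmetric]) simp
      qed
    qed
  qed
  \<comment> \<open>A second derivative at \<open>x\<close> presupposes the first one in a
    neighbourhood. This holds at every point of the open interval because \<open>u1 t\<close> is
    continuous; only its own differentiability is restricted to almost every point.\<close>
  have space: "AE x in lebesgue. x \<in> {0<..<t} \<longrightarrow> has_second_derivative (\<lambda>y. wave q f y t) (u2 t x) x" for t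
    using du1[of t]
  proof eventually_elim
    fix x
    assume *: "x \<in> {0<..<t} \<longrightarrow> (u1 t has_vector_derivative u2 t x) (at x)"
    show "x \<in> {0<..<t} \<longrightarrow> has_second_derivative (\<lambda>y. wave q f y t) (u2 t x) x"
    proof
      assume x: "x \<in> {0<..<t}"
      then have "\<forall>\<^sub>F z in nhds x. z \<in> {0<..<t}" by (intro eventually_nhds_in_open) auto
      then have "\<forall>\<^sub>F z in nhds x. ((\<lambda>y. wave q f y t) has_vector_derivative u1 t z) (at z)"
        by eventually_elim (rule dwave_at)
      with * x show "has_second_derivative (\<lambda>y. wave q f y t) (u2 t x) x"
        unfolding has_second_derivative_def by blast
    qed
  qed
  show ?thesis
  proof (intro conjI allI impI)
    fix t :: real assume "t > 0"
    show "AE x in lebesgue. x \<in> {0<..<t} \<longrightarrow>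
            (\<exists>u_tt u_xx.
               has_second_derivative (\<lambda>\<tau>. wave q f x \<tau>) u_tt t \<and>
               has_second_derivative (\<lambda>y. wave q f y t) u_xx x \<and>
               u_tt - u_xx + q x *v wave q f x t = 0)"
      using space[of t]
    proof eventually_elim
      fix x assume *: "x \<in> {0<..<t} \<longrightarrow> has_second_derivative (\<lambda>y. wave q f y t) (u2 t x) x"
      show "x \<in> {0<..<t} \<longrightarrow> (\<exists>u_tt u_xx.
               has_second_derivative (\<lambda>\<tau>. wave q f x \<tau>) u_tt t \<and>
               has_second_derivative (\<lambda>y. wave q f y t) u_xx x \<and>
               u_tt - u_xx + q x *v wave q f x t = 0)"
      proof
        assume x: "x \<in> {0<..<t}"
        then have "response V G x t - u2 t x + q x *v wave q f x t = 0" by (simp add: u2_def wave)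
        with * x time[of x t] show "\<exists>u_tt u_xx.
               has_second_derivative (\<lambda>\<tau>. wave q f x \<tau>) u_tt t \<and>
               has_second_derivative (\<lambda>y. wave q f y t) u_xx x \<and>
               u_tt - u_xx + q x *v wave q f x t = 0" by auto
      qed
    qed
  next
    fix t x :: real assume "t \<ge> 0" "x \<ge> t"
    then show "wave q f x t = 0" by (simp add: wave response_eq_0[OF F])
  next
    fix t :: real assume "t \<ge> 0"
    then show "wave q f 0 t = f t" using u1_int[of 0 t] by (simp add: wave F_f)
  next
    fix t :: real assume "t \<ge> 0"
    show "sobolev_W21 t (\<lambda>x. wave q f x t)"
      unfolding sobolev_W21_def
    proof (rule exI[of _ "u1 t"], rule exI[of _ "u2 t"], intro conjI ballI)
      show "abs_continuous_on_interval 0 t (\<lambda>x. wave q f x t)"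
        by (rule abs_continuous_on_interval_indefinite_integral[OF absolutely_integrable_continuous_real[OF u1c]])
          (simp add: wave u1_int)
      show "abs_continuous_on_interval 0 t (u1 t)"
        by (rule abs_continuous_on_interval_indefinite_integral[OF u2 u2_int])
    qed (use dwave du1 u2 in auto)
  next
    fix t :: real assume "t \<ge> 0"
    show "\<exists>g. continuous_on {0..t} g \<and>
            (AE x in lebesgue. x \<in> {0<..<t} \<longrightarrow>
              (\<exists>u_xx. has_second_derivative (\<lambda>y. wave q f y t) u_xx x \<and>
                      g x = - u_xx + q x *v wave q f x t))"
    proof (intro exI conjI)
      \<comment> \<open>By the equation the expression in question equals minus the second time
        derivative almost everywhere, and this is continuous in \<open>x\<close>.\<close>
      show "continuous_on {0..t} (\<lambda>x. - response V G x t)"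
        by (intro continuous_intros continuous_on_cont2[OF cont2_response[OF V G]])
      show "AE x in lebesgue. x \<in> {0<..<t} \<longrightarrow>
              (\<exists>u_xx. has_second_derivative (\<lambda>y. wave q f y t) u_xx x \<and>
                      - response V G x t = - u_xx + q x *v wave q f x t)"
        using space[of t] by eventually_elim (auto simp: u2_def wave)
    qed
  qed
qed

end
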